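(* Let $(\Omega,\mathcal{F},\mathbb{P})$ be a complete probability space, let $X_1,X_2,W,R$ be real, reflexive, separable Banach spaces, and let the data $C_1,C_2,K,J_1,J_2,e,i$ satisfy the Basic Assumption stated in the context. Suppose $C_1$ and $C_2$ are bounded sets. Then $$-\infty<\min \mathrm{P}=\sup\mathrm{D},$$ meaning that the primal problem $(\mathrm{P})$ attains its minimum, and the minimal value coincides with the supremum of the dual problem $(\mathrm{D})$, which need not be attained.
   Context: Basic Assumption. $C_1\subset X_1$ and $C_2\subset X_2$ are nonempty, closed, convex sets and $K\subset R$ is a nonempty, closed, convex cone. $J(x_1,x_2)=J_1(x_1)+J_2(x_1,x_2)$ is convex on $X_1\times X_2$ and everywhere defined and finite; for every $r>0$ there is $a_r>0$ such that $|J_2(x_1,x_2)|\le a_r$ whenever $\|x_1\|_{X_1}+\|x_2\|_{X_2}\le r$. The maps $e:X_1\times X_2\times\Omega\to W$ and $i:X_1\times X_2\times\Omega\to R$ are such that $e(x_1,x_2,\omega)$ is continuous and linear in $(x_1,x_2)$, $i(x_1,x_2,\omega)$ is continuous and $K$-convex in $(x_1,x_2)$, both are measurable (in $\omega$), and for every $r>0$ there are $b_{r,e},b_{r,i}>0$ such that $\|e(x_1,x_2,\omega)\|_W\le b_{r,e}$ and $\|i(x_1,x_2,\omega)\|_R\le b_{r,i}$ a.s. whenever $\|x_1\|_{X_1}+\|x_2\|_{X_2}\le r$. Here $r\le_K 0$ means $-r\in K$ (and $r\le_K r'$ means $r'-r\in K$), and $K$-convexity of $i(\cdot,\cdot,\omega)$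 means $i(\lambda x_1+(1-\lambda)\hat{x}_1,\lambda x_2+(1-\lambda)\hat{x}_2,\omega)\le_K\lambda i(x_1,x_2,\omega)+(1-\lambda)i(\hat{x}_1,\hat{x}_2,\omega)$ for all $(x_1,x_2),(\hat{x}_1,\hat{x}_2)\in X_1\times X_2$ and $\lambda\in(0,1)$. Spaces. $X:=X_1\times L^\infty(\Omega,X_2)$, $U:=L^\infty(\Omega,W)\times L^\infty(\Omega,R)$, $\Lambda:=L^1(\Omega,W^* )\times L^1(\Omega,R^* )$ (Bochner spaces), paired by $\langle u,\lambda\rangle_{U,\Lambda}:=\int_\Omega\langle u_e(\omega),\lambda_e(\omega)\rangle_{W,W^*}+\langle u_i(\omega),\lambda_i(\omega)\rangle_{R,R^*}\,d\mathbb{P}(\omega)$ for $u=(u_e,u_i)$, $\lambda=(\lambda_e,\lambda_i)$. Primal problem $(\mathrm{P})$: minimize $j(x):=J_1(x_1)+\mathbb{E}[J_2(x_1,x_2(\cdot))]$ over $x=(x_1,x_2)\in X$ subject to $x_1\in C_1$ and, almost surely, $x_2(\omega)\in C_2$, $e(x_1,x_2(\omega),\omega)=0$, $i(x_1,x_2(\omega),\omega)\le_K0$. Perturbed objective: $\varphi(x,u):=j(x)$ if $x_1\in C_1$ and almost surely $x_2(\omega)\in C_2$, $e(x_1,x_2(\omega),\omega)=u_e(\omega)$, $i(x_1,x_2(\omega),\omega)\le_K u_i(\omega)$; $\varphi(x,u):=\infty$ otherwise. Thus $\inf\mathrm{P}=\inf_{x\in X}\varphi(x,0)$. Generalized Lagrangian: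 $L(x,\lambda):=\inf_{u\in U}\{\langle u,\lambda\rangle_{U,\Lambda}+\varphi(x,u)\}$ on $X\times\Lambda$. Dual problem $(\mathrm{D})$: maximize $g(\lambda):=\inf_{x\in X}L(x,\lambda)$ over $\lambda\in\Lambda$.
   Formalization: The formal theorem additionally assumes that J = J_1 + J_2 is continuous on X_1×X_2; without this the claim fails, e.g. for J_2 = 0, J_1 a discontinuous linear functional on ℓ² and C_1 the closed unit ball, where inf P = −∞. *)

theory Defs
  imports "HOL-Probability.Probability"
begin

text \<open>
  Separable Banach spaces are types of class \<open>banach\<close> and \<open>second_countable_topology\<close> (for a metric
  space, second countability is separability).  The dual of \<open>'a\<close> is \<open>'a \<Rightarrow>\<^sub>L real\<close>.
  Elements of Bochner spaces are represented by functions rather than by classes of almost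
  everywhere equal functions; everything below is invariant under almost everywhere equality.
\<close>

text \<open>Surjectivity of the canonical embedding into the bidual, written out pointwise.\<close>

definition reflexive_space :: "'a::real_normed_vector itself \<Rightarrow> bool" where
  "reflexive_space T \<longleftrightarrow>
     (\<forall>\<Phi> :: ('a \<Rightarrow>\<^sub>L real) \<Rightarrow>\<^sub>L real. \<exists>x::'a. \<forall>f. blinfun_apply \<Phi> f = blinfun_apply f x)"

text \<open>
  The library's \<open>integrable\<close> requires a second countable target type, which is not available for
  the type \<open>'a \<Rightarrow>\<^sub>L real\<close>.  Bochner spaces are therefore based on strong measurability.
\<close>

definition strongly_measurable :: "'o measure \<Rightarrow> ('o \<Rightarrow> 'a::real_normed_vector) \<Rightarrow> bool" where
  "strongly_measurable M f \<longleftrightarrow>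
     (\<exists>s. (\<forall>n::nat. simple_function M (s n)) \<and> (AE \<omega> in M. (\<lambda>n. s n \<omega>) \<longlonglongrightarrow> f \<omega>))"

definition bochner_L1 :: "'o measure \<Rightarrow> ('o \<Rightarrow> 'a::real_normed_vector) set" where
  "bochner_L1 M = {f. strongly_measurable M f \<and> integrable M (\<lambda>\<omega>. norm (f \<omega>))}"

definition bochner_Linf :: "'o measure \<Rightarrow> ('o \<Rightarrow> 'a::real_normed_vector) set" where
  "bochner_Linf M = {f. strongly_measurable M f \<and> (\<exists>B. AE \<omega> in M. norm (f \<omega>) \<le> B)}"

definition cone_le :: "'r::real_vector set \<Rightarrow> 'r \<Rightarrow> 'r \<Rightarrow> bool" where
  "cone_le K r r' \<longleftrightarrow> r' - r \<in> K"

definition cone_convex :: "'r::real_vector set \<Rightarrow> ('a::real_vector \<Rightarrow> 'r) \<Rightarrow> bool" where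
  "cone_convex K f \<longleftrightarrow>
     (\<forall>x y. \<forall>t\<in>{0<..<1::real}.
        cone_le K (f (t *\<^sub>R x + (1 - t) *\<^sub>R y)) (t *\<^sub>R f x + (1 - t) *\<^sub>R f y))"

text \<open>
  These conditions do not make \<open>J1 + J2\<close> continuous on infinite-dimensional spaces: \<open>J1\<close> may be a
  discontinuous linear functional, whose infimum over a closed ball is \<open>-\<infinity>\<close>.  Continuity of
  \<open>J1 + J2\<close> is therefore stated as a separate hypothesis of the theorem.
\<close>

definition basic_assumption ::
  "'o measure \<Rightarrow> 'x1::real_normed_vector set \<Rightarrow> 'x2::real_normed_vector set \<Rightarrow>
   'r::real_normed_vector set \<Rightarrow> ('x1 \<Rightarrow> real) \<Rightarrow> ('x1 \<Rightarrow> 'x2 \<Rightarrow> real) \<Rightarrow>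
   ('x1 \<Rightarrow> 'x2 \<Rightarrow> 'o \<Rightarrow> 'w::real_normed_vector) \<Rightarrow> ('x1 \<Rightarrow> 'x2 \<Rightarrow> 'o \<Rightarrow> 'r) \<Rightarrow> bool" where
  "basic_assumption M C1 C2 K J1 J2 e i \<longleftrightarrow>
     C1 \<noteq> {} \<and> closed C1 \<and> convex C1 \<and>
     C2 \<noteq> {} \<and> closed C2 \<and> convex C2 \<and>
     K \<noteq> {} \<and> closed K \<and> convex K \<and> cone K \<and>
     convex_on UNIV (\<lambda>(x1, x2). J1 x1 + J2 x1 x2) \<and>
     (\<forall>r>0. \<exists>a>0. \<forall>x1 x2. norm x1 + norm x2 \<le> r \<longrightarrow> \<bar>J2 x1 x2\<bar> \<le> a) \<and>
     (\<forall>\<omega>\<in>space M. bounded_linear (\<lambda>(x1, x2). e x1 x2 \<omega>)) \<and>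
     (\<forall>\<omega>\<in>space M. continuous_on UNIV (\<lambda>(x1, x2). i x1 x2 \<omega>)) \<and>
     (\<forall>\<omega>\<in>space M. cone_convex K (\<lambda>(x1, x2). i x1 x2 \<omega>)) \<and>
     (\<forall>x1 x2. e x1 x2 \<in> borel_measurable M) \<and>
     (\<forall>x1 x2. i x1 x2 \<in> borel_measurable M) \<and>
     (\<forall>r>0. \<exists>b>0. \<forall>x1 x2. norm x1 + norm x2 \<le> r \<longrightarrow> (AE \<omega> in M. norm (e x1 x2 \<omega>) \<le> b)) \<and>
     (\<forall>r>0. \<exists>b>0. \<forall>x1 x2. norm x1 + norm x2 \<le> r \<longrightarrow> (AE \<omega> in M. norm (i x1 x2 \<omega>) \<le> b))"

definition primal_space ::
  "'o measure \<Rightarrow> ('x1::real_normed_vector \<times> ('o \<Rightarrow> 'x2::real_normed_vector)) set" where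
  "primal_space M = UNIV \<times> bochner_Linf M"

definition perturbation_space ::
  "'o measure \<Rightarrow> (('o \<Rightarrow> 'w::real_normed_vector) \<times> ('o \<Rightarrow> 'r::real_normed_vector)) set" where
  "perturbation_space M = bochner_Linf M \<times> bochner_Linf M"

definition multiplier_space ::
  "'o measure \<Rightarrow> (('o \<Rightarrow> 'w::real_normed_vector \<Rightarrow>\<^sub>L real) \<times> ('o \<Rightarrow> 'r::real_normed_vector \<Rightarrow>\<^sub>L real)) set"
  where "multiplier_space M = bochner_L1 M \<times> bochner_L1 M"

definition pairing ::
  "'o measure \<Rightarrow> ('o \<Rightarrow> 'w::real_normed_vector) \<times> ('o \<Rightarrow> 'r::real_normed_vector) \<Rightarrow>
   ('o \<Rightarrow> 'w \<Rightarrow>\<^sub>L real) \<times> ('o \<Rightarrow> 'r \<Rightarrow>\<^sub>L real) \<Rightarrow> real" where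
  "pairing M u l =
     (\<integral>\<omega>. blinfun_apply (fst l \<omega>) (fst u \<omega>) + blinfun_apply (snd l \<omega>) (snd u \<omega>) \<partial>M)"

definition objective ::
  "'o measure \<Rightarrow> ('x1 \<Rightarrow> real) \<Rightarrow> ('x1 \<Rightarrow> 'x2 \<Rightarrow> real) \<Rightarrow> 'x1 \<times> ('o \<Rightarrow> 'x2) \<Rightarrow> real" where
  "objective M J1 J2 x = J1 (fst x) + (\<integral>\<omega>. J2 (fst x) (snd x \<omega>) \<partial>M)"

definition primal_feasible ::
  "'o measure \<Rightarrow> 'x1::real_normed_vector set \<Rightarrow> 'x2::real_normed_vector set \<Rightarrow>
   'r::real_normed_vector set \<Rightarrow>
   ('x1 \<Rightarrow> 'x2 \<Rightarrow> 'o \<Rightarrow> 'w::real_normed_vector) \<Rightarrow> ('x1 \<Rightarrow> 'x2 \<Rightarrow> 'o \<Rightarrow> 'r) \<Rightarrow>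
   ('x1 \<times> ('o \<Rightarrow> 'x2)) set" where
  "primal_feasible M C1 C2 K e i =
     {x \<in> primal_space M. fst x \<in> C1 \<and>
        (AE \<omega> in M. snd x \<omega> \<in> C2 \<and> e (fst x) (snd x \<omega>) \<omega> = 0 \<and>
           cone_le K (i (fst x) (snd x \<omega>) \<omega>) 0)}"

text \<open>The infimum is \<open>\<infinity>\<close> if there is no feasible point.\<close>

definition primal_value ::
  "'o measure \<Rightarrow> 'x1::real_normed_vector set \<Rightarrow> 'x2::real_normed_vector set \<Rightarrow>
   'r::real_normed_vector set \<Rightarrow> ('x1 \<Rightarrow> real) \<Rightarrow> ('x1 \<Rightarrow> 'x2 \<Rightarrow> real) \<Rightarrow>
   ('x1 \<Rightarrow> 'x2 \<Rightarrow> 'o \<Rightarrow> 'w::real_normed_vector) \<Rightarrow> ('x1 \<Rightarrow> 'x2 \<Rightarrow> 'o \<Rightarrow> 'r) \<Rightarrow> ereal" where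
  "primal_value M C1 C2 K J1 J2 e i =
     (INF x\<in>primal_feasible M C1 C2 K e i. ereal (objective M J1 J2 x))"

definition perturbed_objective ::
  "'o measure \<Rightarrow> 'x1::real_normed_vector set \<Rightarrow> 'x2::real_normed_vector set \<Rightarrow>
   'r::real_normed_vector set \<Rightarrow> ('x1 \<Rightarrow> real) \<Rightarrow> ('x1 \<Rightarrow> 'x2 \<Rightarrow> real) \<Rightarrow>
   ('x1 \<Rightarrow> 'x2 \<Rightarrow> 'o \<Rightarrow> 'w::real_normed_vector) \<Rightarrow> ('x1 \<Rightarrow> 'x2 \<Rightarrow> 'o \<Rightarrow> 'r) \<Rightarrow>
   'x1 \<times> ('o \<Rightarrow> 'x2) \<Rightarrow> ('o \<Rightarrow> 'w) \<times> ('o \<Rightarrow> 'r) \<Rightarrow> ereal" where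
  "perturbed_objective M C1 C2 K J1 J2 e i x u =
     (if fst x \<in> C1 \<and>
         (AE \<omega> in M. snd x \<omega> \<in> C2 \<and> e (fst x) (snd x \<omega>) \<omega> = fst u \<omega> \<and>
            cone_le K (i (fst x) (snd x \<omega>) \<omega>) (snd u \<omega>))
      then ereal (objective M J1 J2 x) else \<infinity>)"

definition lagrangian ::
  "'o measure \<Rightarrow> 'x1::real_normed_vector set \<Rightarrow> 'x2::real_normed_vector set \<Rightarrow>
   'r::real_normed_vector set \<Rightarrow> ('x1 \<Rightarrow> real) \<Rightarrow> ('x1 \<Rightarrow> 'x2 \<Rightarrow> real) \<Rightarrow>
   ('x1 \<Rightarrow> 'x2 \<Rightarrow> 'o \<Rightarrow> 'w::real_normed_vector) \<Rightarrow> ('x1 \<Rightarrow> 'x2 \<Rightarrow> 'o \<Rightarrow> 'r) \<Rightarrow>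
   'x1 \<times> ('o \<Rightarrow> 'x2) \<Rightarrow> ('o \<Rightarrow> 'w \<Rightarrow>\<^sub>L real) \<times> ('o \<Rightarrow> 'r \<Rightarrow>\<^sub>L real) \<Rightarrow> ereal" where
  "lagrangian M C1 C2 K J1 J2 e i x l =
     (INF u\<in>perturbation_space M.
        ereal (pairing M u l) + perturbed_objective M C1 C2 K J1 J2 e i x u)"

definition dual_objective ::
  "'o measure \<Rightarrow> 'x1::real_normed_vector set \<Rightarrow> 'x2::real_normed_vector set \<Rightarrow>
   'r::real_normed_vector set \<Rightarrow> ('x1 \<Rightarrow> real) \<Rightarrow> ('x1 \<Rightarrow> 'x2 \<Rightarrow> real) \<Rightarrow>
   ('x1 \<Rightarrow> 'x2 \<Rightarrow> 'o \<Rightarrow> 'w::real_normed_vector) \<Rightarrow> ('x1 \<Rightarrow> 'x2 \<Rightarrow> 'o \<Rightarrow> 'r) \<Rightarrow>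
   ('o \<Rightarrow> 'w \<Rightarrow>\<^sub>L real) \<times> ('o \<Rightarrow> 'r \<Rightarrow>\<^sub>L real) \<Rightarrow> ereal" where
  "dual_objective M C1 C2 K J1 J2 e i l =
     (INF x\<in>primal_space M. lagrangian M C1 C2 K J1 J2 e i x l)"

definition dual_value ::
  "'o measure \<Rightarrow> 'x1::real_normed_vector set \<Rightarrow> 'x2::real_normed_vector set \<Rightarrow>
   'r::real_normed_vector set \<Rightarrow> ('x1 \<Rightarrow> real) \<Rightarrow> ('x1 \<Rightarrow> 'x2 \<Rightarrow> real) \<Rightarrow>
   ('x1 \<Rightarrow> 'x2 \<Rightarrow> 'o \<Rightarrow> 'w::real_normed_vector) \<Rightarrow> ('x1 \<Rightarrow> 'x2 \<Rightarrow> 'o \<Rightarrow> 'r) \<Rightarrow> ereal" where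
  "dual_value M C1 C2 K J1 J2 e i =
     (SUP l\<in>multiplier_space M. dual_objective M C1 C2 K J1 J2 e i l)"

lemma primal_value_eq_perturbed:
  "primal_value M C1 C2 K J1 J2 e i =
     (INF x\<in>primal_space M. perturbed_objective M C1 C2 K J1 J2 e i x (\<lambda>_. 0, \<lambda>_. 0))"
  unfolding primal_value_def
proof (rule antisym)
  show "(INF x\<in>primal_feasible M C1 C2 K e i. ereal (objective M J1 J2 x))
      \<le> (INF x\<in>primal_space M. perturbed_objective M C1 C2 K J1 J2 e i x (\<lambda>_. 0, \<lambda>_. 0))"
    by (rule INF_greatest) (auto simp: perturbed_objective_def primal_feasible_def intro!: INF_lower)
  show "(INF x\<in>primal_space M. perturbed_objective M C1 C2 K J1 J2 e i x (\<lambda>_. 0, \<lambda>_. 0))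
      \<le> (INF x\<in>primal_feasible M C1 C2 K e i. ereal (objective M J1 J2 x))"
  proof (rule INF_greatest)
    fix x assume x: "x \<in> primal_feasible M C1 C2 K e i"
    then have "x \<in> primal_space M"
      "perturbed_objective M C1 C2 K J1 J2 e i x (\<lambda>_. 0, \<lambda>_. 0) = ereal (objective M J1 J2 x)"
      by (auto simp: perturbed_objective_def primal_feasible_def)
    then show "(INF x\<in>primal_space M. perturbed_objective M C1 C2 K J1 J2 e i x (\<lambda>_. 0, \<lambda>_. 0))
        \<le> ereal (objective M J1 J2 x)"
      by (metis INF_lower)
  qed
qed

end

theory Submission
  imports Defs
begin

text \<open>
  The cone \<open>{0} \<times> K\<close> is an intersection of countably many half-spaces \<open>0 \<le> \<kappa> k z\<close>, so the constraints
  amount to countably many scalar convex constraints \<open>c k \<le> 0\<close>, where \<open>c k = \<kappa> k \<circ> (e, i)\<close>.  Penalize the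
  first \<open>n\<close> of them by \<open>n (max 0 (c k))\<^sup>2\<close>.  The penalized problem has a minimizer \<open>y n\<close>, and its first-order
  optimality condition says that \<open>\<Sum>k<n. 2 n max 0 (c k (y n)) \<kappa> k\<close> is a dual point whose value is at least the
  minimal penalized value \<open>p n\<close>.  This multiplier is a finite sum of bounded scalar functions times
  fixed functionals, so no duality theory of Bochner spaces is needed.  If \<open>p n\<close> is bounded, then a
  limit of the minimizers is feasible with objective at most \<open>sup p n\<close>, which closes the gap.

  Compactness is obtained pointwise: minimizing a weak Hilbertian seminorm over decreasing bounded
  convex sets of functions selects a sequence that converges weakly at almost every \<open>\<omega>\<close>; closed convex
  constraints and (by Fatou's lemma) convex integral functionals pass to such limits.
\<close>

text \<open>Nothing bounds the multipliers uniformly in \<open>n\<close>, in line with a dual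
  supremum that need not be attained. Hence only their dual values are compared with
  \<open>p n\<close>, and only the minimizers pass to a limit. Scalarizing the constraints first
  keeps the penalty elementary: (max 0 s)^2 has derivative 2 max 0 s, whatever the geometry of the
  constraint spaces.

  Compactness is delicate because the constraints hold pointwise: a bounded sequence of decisions
  has weakly convergent subsequences at each \<omega>, but they depend on \<omega>. Near-minimality
  in a Hilbertian seminorm makes, by the parallelogram law, consecutive differences so small that
  the selected sequence itself converges at almost every \<omega>.

  The values \<open>p n\<close> are bounded exactly when the problem is feasible: a feasible point
  has zero penalty and so bounds them all. If they are unbounded, both optimal values are infinite
  and every point of the primal space attains the minimum.\<close>

subsection \<open>Subgradients and separation\<close>

text \<open>Zorn's lemma is applied to the convex functions below \<open>p0\<close> that vanish at
  0. A minimal one is linear because two modifications stay in this family and lie below it, hence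
  equal it: \<open>p (s *\<^sub>R x) / s\<close> for s in (0,1) gives homogeneity, and the infimum
  of \<open>p (x + t *\<^sub>R y) - t * p y\<close> over t \<ge> 0 gives additivity.\<close>

lemma exists_linear_minorant:
  fixes p0 :: "'a::real_vector \<Rightarrow> real"
  assumes cvx0: "convex_on UNIV p0" and zero0: "p0 0 = 0"
  shows "\<exists>f. linear f \<and> (\<forall>x. f x \<le> p0 x)"
proof -
  define cvx :: "('a \<Rightarrow> real) \<Rightarrow> bool" where
    "cvx p \<longleftrightarrow> (\<forall>x y t. 0 \<le> t \<longrightarrow> t \<le> 1 \<longrightarrow> p (t *\<^sub>R x + (1 - t) *\<^sub>R y) \<le> t * p x + (1 - t) * p y)" for p
  define S where "S = {p. cvx p \<and> p 0 = 0 \<and> (\<forall>x. p x \<le> p0 x)}"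
  have cvxD: "p (t *\<^sub>R x + s *\<^sub>R y) \<le> t * p x + s * p y"
    if "cvx p" "0 \<le> t" "0 \<le> s" "t + s = 1" for p t s x y
  proof -
    have s: "s = 1 - t" and "t \<le> 1" using that by auto
    then show ?thesis using that(1)[unfolded cvx_def, rule_format, of t x y] that(2) by simp
  qed
  have p0S: "p0 \<in> S"
    using cvx0 zero0 unfolding S_def cvx_def by (auto simp: convex_on_alt)
  \<comment> \<open>Convexity at the midpoint of \<open>x\<close> and \<open>- x\<close>. This bound
    keeps the infima over chains finite.\<close>
  have low: "- p0 (- x) \<le> p x" if "p \<in> S" for p x
  proof -
    have "p ((1/2) *\<^sub>R x + (1/2) *\<^sub>R (- x)) \<le> 1/2 * p x + 1/2 * p (- x)"
      using that cvxD[of p "1/2" "1/2" x "- x"] by (auto simp: S_def)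
    moreover have "p ((1/2) *\<^sub>R x + (1/2) *\<^sub>R (- x)) = 0" using that by (simp add: S_def)
    moreover have "p (- x) \<le> p0 (- x)" using that by (simp add: S_def)
    ultimately show ?thesis by linarith
  qed
  \<comment> \<open>The order is reversed because \<open>predicate_Zorn\<close> yields a maximal
    element.\<close>
  define R :: "('a \<Rightarrow> real) \<Rightarrow> ('a \<Rightarrow> real) \<Rightarrow> bool" where "R = (\<lambda>f g. g \<le> f)"
  have "\<exists>m\<in>S. \<forall>a\<in>S. R m a \<longrightarrow> a = m"
  proof (rule predicate_Zorn)
    show "partial_order_on S (relation_of R S)"
      by (rule partial_order_on_relation_ofI) (auto simp: R_def)
  next
    fix C assume C: "C \<in> Chains (relation_of R S)"
    then have CS: "C \<subseteq> S" and tot: "\<And>p q. p \<in> C \<Longrightarrow> q \<in> C \<Longrightarrow> p \<le> q \<or> q \<le> p"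
      unfolding Chains_def relation_of_def R_def by auto
    show "\<exists>u\<in>S. \<forall>a\<in>C. R a u"
    proof (cases "C = {}")
      case True then show ?thesis using p0S by auto
    next
      case False
      define u where "u x = (INF p\<in>C. p x)" for x
      have bdd: "bdd_below ((\<lambda>p. p x) ` C)" for x
        using low CS by (intro bdd_belowI2[of _ "- p0 (- x)"]) auto
      have ule: "u x \<le> p x" if "p \<in> C" for p x
        unfolding u_def using bdd that by (rule cINF_lower)
      have uex: "\<exists>p\<in>C. p x < u x + d" if "0 < d" for x d
        using cInf_lessD[of "(\<lambda>p. p x) ` C" "u x + d"] False that unfolding u_def by auto
      have "cvx u" unfolding cvx_def
      proof (intro allI impI)
        fix x y t assume t: "(0::real) \<le> t" "t \<le> 1"
        show "u (t *\<^sub>R x + (1 - t) *\<^sub>R y) \<le> t * u x + (1 - t) * u y"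
        proof (rule field_le_epsilon)
          fix d :: real assume d: "0 < d"
          obtain p where p: "p \<in> C" "p x < u x + d" using uex[OF d] by blast
          obtain q where q: "q \<in> C" "q y < u y + d" using uex[OF d] by blast
          \<comment> \<open>The chain supplies one function that is nearly minimal at both points;
            this is what makes the infimum convex.\<close>
          obtain r where r: "r \<in> C" "r \<le> p" "r \<le> q" using tot[OF p(1) q(1)] p(1) q(1) by auto
          have rx: "r x \<le> u x + d" "r y \<le> u y + d" using r p q by (auto simp: le_fun_def intro: order_trans less_imp_le)
          have "u (t *\<^sub>R x + (1 - t) *\<^sub>R y) \<le> r (t *\<^sub>R x + (1 - t) *\<^sub>R y)" using ule r by auto
          also have "\<dots> \<le> t * r x + (1 - t) * r y"
            using r CS t by (intro cvxD) (auto simp: S_def)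
          also have "\<dots> \<le> t * (u x + d) + (1 - t) * (u y + d)"
            using rx t by (intro add_mono mult_left_mono) auto
          finally show "u (t *\<^sub>R x + (1 - t) *\<^sub>R y) \<le> t * u x + (1 - t) * u y + d"
            by (simp add: algebra_simps)
        qed
      qed
      moreover have "u 0 = 0"
      proof -
        have "(\<lambda>p. p 0) ` C = (\<lambda>p. 0) ` C" using CS by (intro image_cong) (auto simp: S_def)
        then have "(\<lambda>p. p 0) ` C = {0}" using False by auto
        then show ?thesis unfolding u_def by simp
      qed
      moreover have "u x \<le> p0 x" for x
      proof -
        obtain p where "p \<in> C" using False by auto
        then show ?thesis using ule[of p x] CS by (auto simp: S_def intro: order_trans)
      qed
      ultimately have "u \<in> S" by (simp add: S_def)
      then show ?thesis using ule by (auto simp: R_def le_fun_def)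
    qed
  qed
  then obtain p where pS: "p \<in> S" and pmin: "\<And>a. a \<in> S \<Longrightarrow> a \<le> p \<Longrightarrow> a = p"
    by (auto simp: R_def)
  have pc: "cvx p" and p00: "p 0 = 0" and ple: "\<And>x. p x \<le> p0 x" using pS by (auto simp: S_def)
  have scale1: "p (s *\<^sub>R x) = s * p x" if s: "0 < s" "s < 1" for s x
  proof -
    define a where "a x = p (s *\<^sub>R x) / s" for x
    have ale: "a x \<le> p x" for x
      using cvxD[OF pc, of s "1 - s" x 0] s p00 by (simp add: a_def field_simps)
    have "cvx a" unfolding cvx_def
    proof (intro allI impI)
      fix x y t assume t: "(0::real) \<le> t" "t \<le> 1"
      have "p (t *\<^sub>R (s *\<^sub>R x) + (1 - t) *\<^sub>R (s *\<^sub>R y)) \<le> t * p (s *\<^sub>R x) + (1 - t) * p (s *\<^sub>R y)"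
        using t by (intro cvxD pc) auto
      then show "a (t *\<^sub>R x + (1 - t) *\<^sub>R y) \<le> t * a x + (1 - t) * a y"
        using s by (simp add: a_def field_simps scaleR_add_right)
    qed
    then have "a \<in> S" using ale ple p00 by (auto simp: S_def a_def intro: order_trans)
    then have "a = p" using ale by (intro pmin) (auto simp: le_fun_def)
    then show ?thesis using s unfolding a_def by (metis nonzero_mult_div_cancel_left less_numeral_extra(3) times_divide_eq_right)
  qed
  have scale: "p (s *\<^sub>R x) = s * p x" if s: "0 < s" for s x
  proof -
    consider "s < 1" | "s = 1" | "1 < s" by linarith
    then show ?thesis
    proof cases
      case 3
      then have "p (inverse s *\<^sub>R (s *\<^sub>R x)) = inverse s * p (s *\<^sub>R x)"
        by (intro scale1) (auto simp: field_simps)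
      then show ?thesis using 3 by (simp add: field_simps)
    qed (use s scale1 in auto)
  qed
  have sub: "p (x + y) \<le> p x + p y" for x y
  proof -
    have "p (x + y) = p ((1/2) *\<^sub>R (2 *\<^sub>R x) + (1/2) *\<^sub>R (2 *\<^sub>R y))" by simp
    also have "\<dots> \<le> 1/2 * p (2 *\<^sub>R x) + 1/2 * p (2 *\<^sub>R y)" by (intro cvxD pc) auto
    finally show ?thesis using scale[of 2] by simp
  qed
  have add: "p (x + y) = p x + p y" for x y
  proof -
    \<comment> \<open>Minimality will force \<open>a = p\<close>, and the choice t = 1 in the
      infimum then gives superadditivity.\<close>
    define a where "a x = (INF t\<in>{0..}. p (x + t *\<^sub>R y) - t * p y)" for x
    have scale0: "p (t *\<^sub>R z) = t * p z" if "0 \<le> t" for t z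
      using scale[of t z] that p00 by (cases "t = 0") auto
    have lb: "- p (- x) \<le> p (x + t *\<^sub>R y) - t * p y" if "0 \<le> t" for t x
      using sub[of "x + t *\<^sub>R y" "- x"] scale0[OF that, of y] by simp
    have bdd: "bdd_below ((\<lambda>t. p (x + t *\<^sub>R y) - t * p y) ` {0..})" for x
      using lb by (intro bdd_belowI2[of _ "- p (- x)"]) auto
    have ale: "a x \<le> p (x + t *\<^sub>R y) - t * p y" if "0 \<le> t" for x t
      unfolding a_def using bdd that by (intro cINF_lower) auto
    have aex: "\<exists>t\<ge>0. p (x + t *\<^sub>R y) - t * p y < a x + d" if "0 < d" for x d
      using cInf_lessD[of "(\<lambda>t. p (x + t *\<^sub>R y) - t * p y) ` {0..}" "a x + d"] that
      unfolding a_def by auto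
    have alp: "a x \<le> p x" for x using ale[of 0 x] by simp
    have "cvx a" unfolding cvx_def
    proof (intro allI impI)
      fix x z t assume t: "(0::real) \<le> t" "t \<le> 1"
      show "a (t *\<^sub>R x + (1 - t) *\<^sub>R z) \<le> t * a x + (1 - t) * a z"
      proof (rule field_le_epsilon)
        fix d :: real assume d: "0 < d"
        obtain r where r: "0 \<le> r" "p (x + r *\<^sub>R y) - r * p y < a x + d" using aex[OF d] by blast
        obtain s where s: "0 \<le> s" "p (z + s *\<^sub>R y) - s * p y < a z + d" using aex[OF d] by blast
        have "a (t *\<^sub>R x + (1 - t) *\<^sub>R z)
            \<le> p ((t *\<^sub>R x + (1 - t) *\<^sub>R z) + (t * r + (1 - t) * s) *\<^sub>R y) - (t * r + (1 - t) * s) * p y"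
          using r s t by (intro ale) auto
        also have "(t *\<^sub>R x + (1 - t) *\<^sub>R z) + (t * r + (1 - t) * s) *\<^sub>R y =
            t *\<^sub>R (x + r *\<^sub>R y) + (1 - t) *\<^sub>R (z + s *\<^sub>R y)" by (simp add: algebra_simps)
        also have "p \<dots> \<le> t * p (x + r *\<^sub>R y) + (1 - t) * p (z + s *\<^sub>R y)"
          using t by (intro cvxD pc) auto
        also have "t * p (x + r *\<^sub>R y) + (1 - t) * p (z + s *\<^sub>R y) - (t * r + (1 - t) * s) * p y
           = t * (p (x + r *\<^sub>R y) - r * p y) + (1 - t) * (p (z + s *\<^sub>R y) - s * p y)"
          by (simp add: algebra_simps)
        also have "\<dots> \<le> t * (a x + d) + (1 - t) * (a z + d)"
          using r s t by (intro add_mono mult_left_mono) auto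
        finally show "a (t *\<^sub>R x + (1 - t) *\<^sub>R z) \<le> t * a x + (1 - t) * a z + d"
          by (simp add: algebra_simps)
      qed
    qed
    moreover have "a 0 = 0"
    proof -
      have "(\<lambda>t. p (0 + t *\<^sub>R y) - t * p y) ` {0..} = {0}"
        using scale0 by (auto simp: image_iff intro!: exI[of _ 0])
      then show ?thesis unfolding a_def by simp
    qed
    ultimately have "a \<in> S" using alp ple by (auto simp: S_def intro: order_trans)
    then have "a = p" using alp by (intro pmin) (auto simp: le_fun_def)
    then have "p x \<le> p (x + y) - p y" using ale[of 1 x] by simp
    then show ?thesis using sub[of x y] by simp
  qed
  have "linear p"
  proof (rule linearI)
    have neg: "p (- x) = - p x" for x using add[of x "- x"] p00 by simp
    fix x and r :: real
    show "p (r *\<^sub>R x) = r *\<^sub>R p x"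
    proof -
      consider "r = 0" | "0 < r" | "r < 0" by linarith
      then show ?thesis
      proof cases
        case 3
        then have "p ((- r) *\<^sub>R x) = (- r) * p x" by (intro scale) auto
        then show ?thesis using neg by simp
      qed (use p00 scale in auto)
    qed
  qed (rule add)
  then show ?thesis using ple by blast
qed

text \<open>Continuity at \<open>z\<close> makes the algebraic minorant bounded: it lies below the
  increment \<open>p0\<close>, so it is at most 1 on a small ball, and linearity turns this
  one-sided bound into a norm bound.\<close>

lemma exists_subgradient:
  fixes p :: "'a::real_normed_vector \<Rightarrow> real"
  assumes cvx: "convex_on UNIV p" and cont: "isCont p z"
  shows "\<exists>f :: 'a \<Rightarrow>\<^sub>L real. \<forall>y. p z + f (y - z) \<le> p y"
proof -
  define p0 where "p0 h = p (z + h) - p z" for h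
  have "convex_on UNIV p0"
  proof (rule convex_onI)
    fix t :: real and x y assume t: "0 < t" "t < 1"
    have "p ((1 - t) *\<^sub>R (z + x) + t *\<^sub>R (z + y)) \<le> (1 - t) * p (z + x) + t * p (z + y)"
      using t by (intro convex_onD[OF cvx]) auto
    moreover have "(1 - t) *\<^sub>R (z + x) + t *\<^sub>R (z + y) = z + ((1 - t) *\<^sub>R x + t *\<^sub>R y)"
      by (simp add: algebra_simps)
    ultimately show "p0 ((1 - t) *\<^sub>R x + t *\<^sub>R y) \<le> (1 - t) * p0 x + t * p0 y"
      by (simp add: p0_def algebra_simps)
  qed simp
  then obtain f where f: "linear f" and fle: "\<And>h. f h \<le> p0 h"
    using exists_linear_minorant[of p0] by (auto simp: p0_def)
  obtain d where d: "0 < d" "\<And>y. dist y z < d \<Longrightarrow> dist (p y) (p z) < 1"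
    using cont unfolding continuous_at_eps_delta by (metis zero_less_one)
  have small: "f h \<le> 1" if "norm h < d" for h
    using d(2)[of "z + h"] that fle[of h] by (auto simp: p0_def dist_norm)
  have bd: "f h \<le> norm h * (2 / d)" for h
  proof (cases "h = 0")
    case True then show ?thesis using f by (simp add: linear_0)
  next
    case False
    \<comment> \<open>Rescaling \<open>h\<close> to norm d / 2 keeps it strictly inside the ball;
      this is the origin of the constant 2 / d.\<close>
    have "f ((d / (2 * norm h)) *\<^sub>R h) \<le> 1" using False d by (intro small) auto
    then have "(d / (2 * norm h)) * f h \<le> 1" using f by (simp add: linear_scale)
    then show ?thesis using False d by (simp add: field_simps)
  qed
  have "bounded_linear f"
  proof (rule bounded_linear.intro[OF _ bounded_linear_axioms.intro])
    show "linear f" by (rule f)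
    have "norm (f h) \<le> norm h * (2 / d)" for h
      using bd[of h] bd[of "- h"] f by (auto simp: linear_neg abs_le_iff)
    then show "\<exists>K. \<forall>x. norm (f x) \<le> norm x * K" by blast
  qed
  then have "\<forall>y. p z + blinfun_apply (Blinfun f) (y - z) \<le> p y"
    using fle by (auto simp: bounded_linear_Blinfun_apply p0_def) (metis add.commute add_diff_cancel_left' diff_add_cancel le_diff_eq)
  then show ?thesis by blast
qed

lemma convex_on_infdist:
  fixes C :: "'a::real_normed_vector set"
  assumes "convex C"
  shows "convex_on UNIV (\<lambda>x. infdist x C)"
proof (cases "C = {}")
  case True then show ?thesis by (auto simp: infdist_def intro: convex_onI)
next
  case False
  show ?thesis
  proof (rule convex_onI)
    fix t :: real and x y :: 'a assume t: "0 < t" "t < 1"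
    show "infdist ((1 - t) *\<^sub>R x + t *\<^sub>R y) C \<le> (1 - t) * infdist x C + t * infdist y C"
    proof (rule field_le_epsilon)
      fix d :: real assume d: "0 < d"
      obtain a where a: "a \<in> C" "dist x a < infdist x C + d"
        using cInf_lessD[of "dist x ` C" "infdist x C + d"] d False by (auto simp: infdist_def)
      obtain b where b: "b \<in> C" "dist y b < infdist y C + d"
        using cInf_lessD[of "dist y ` C" "infdist y C + d"] d False by (auto simp: infdist_def)
      have "(1 - t) *\<^sub>R a + t *\<^sub>R b \<in> C" using assms a b t by (intro convexD) auto
      then have "infdist ((1 - t) *\<^sub>R x + t *\<^sub>R y) C \<le> dist ((1 - t) *\<^sub>R x + t *\<^sub>R y) ((1 - t) *\<^sub>R a + t *\<^sub>R b)"
        by (rule infdist_le)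
      also have "\<dots> = norm ((1 - t) *\<^sub>R (x - a) + t *\<^sub>R (y - b))"
        by (simp add: dist_norm algebra_simps)
      also have "\<dots> \<le> (1 - t) * dist x a + t * dist y b"
        using t by (intro norm_triangle_le) (auto simp: dist_norm)
      also have "\<dots> \<le> (1 - t) * (infdist x C + d) + t * (infdist y C + d)"
        using a b t by (intro add_mono mult_left_mono) auto
      finally show "infdist ((1 - t) *\<^sub>R x + t *\<^sub>R y) C \<le> (1 - t) * infdist x C + t * infdist y C + d"
        by (simp add: algebra_simps)
    qed
  qed simp
qed

text \<open>A subgradient of the distance function at \<open>z\<close> separates: the distance
  vanishes on \<open>C\<close> and is positive at \<open>z\<close>, so the gap is
  \<open>infdist z C\<close>.\<close>

lemma separate_point_closed_convex:
  fixes C :: "'a::real_normed_vector set"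
  assumes "convex C" "closed C" "z \<notin> C"
  shows "\<exists>(f :: 'a \<Rightarrow>\<^sub>L real) b. (\<forall>y\<in>C. f y \<le> b) \<and> b < f z"
proof (cases "C = {}")
  case True then show ?thesis by (intro exI[of _ 0] exI[of _ "-1"]) auto
next
  case False
  have "isCont (\<lambda>x. infdist x C) z" by (intro continuous_intros)
  then obtain f :: "'a \<Rightarrow>\<^sub>L real" where f: "\<And>y. infdist z C + f (y - z) \<le> infdist y C"
    using exists_subgradient[OF convex_on_infdist[OF assms(1)], of z] by auto
  have "0 < infdist z C" using assms False by (simp add: infdist_pos_not_in_closed)
  moreover have "f y \<le> f z - infdist z C" if "y \<in> C" for y
    using f[of y] that by (simp add: blinfun.diff_right)
  ultimately show ?thesis by (intro exI[of _ f] exI[of _ "f z - infdist z C"]) auto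
qed

text \<open>The complement of \<open>C\<close> is covered by the open half-spaces that miss
  \<open>C\<close>, and the Lindelof property leaves countably many of them.\<close>

lemma closed_convex_countable_halfspaces:
  fixes C :: "'a::{real_normed_vector, second_countable_topology} set"
  assumes "convex C" "closed C"
  shows "\<exists>(f :: nat \<Rightarrow> 'a \<Rightarrow>\<^sub>L real) b. \<forall>z. z \<in> C \<longleftrightarrow> (\<forall>k. f k z \<le> b k)"
proof -
  define H where "H = {(f :: 'a \<Rightarrow>\<^sub>L real, b). \<forall>y\<in>C. f y \<le> b}"
  define U where "U = (\<lambda>(f :: 'a \<Rightarrow>\<^sub>L real, b). {z. b < f z})"
  have op: "open S" if "S \<in> U ` H" for S
    using that by (auto simp: U_def intro!: open_Collect_less continuous_intros)
  obtain F where F: "F \<subseteq> U ` H" "countable F" "\<Union>F = \<Union>(U ` H)"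
    using Lindelof[OF op] by auto
  have "\<exists>G. countable G \<and> G \<subseteq> H \<and> F = U ` G"
    using countable_subset_image[of F U H] F(1,2) by blast
  then obtain G where G: "G \<subseteq> H" "countable G" "F = U ` G" by blast
  \<comment> \<open>The trivial half-space makes the countable family nonempty, so that it can be
    enumerated by the naturals.\<close>
  have 0: "(0, 0) \<in> H" by (auto simp: H_def)
  define g where "g = from_nat_into (insert (0, 0) G)"
  have rg: "range g = insert (0, 0) G"
    unfolding g_def using G(2) by (intro range_from_nat_into) simp_all
  have iff: "z \<in> C \<longleftrightarrow> (\<forall>k. fst (g k) z \<le> snd (g k))" for z
  proof
    assume "z \<in> C"
    show "\<forall>k. fst (g k) z \<le> snd (g k)"
    proof
      fix k have "g k \<in> insert (0, 0) G" using rg by blast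
      then have "g k \<in> H" using G(1) 0 by (elim insertE) auto
      then show "fst (g k) z \<le> snd (g k)" using \<open>z \<in> C\<close> by (simp add: H_def split: prod.splits)
    qed
  next
    assume le: "\<forall>k. fst (g k) z \<le> snd (g k)"
    show "z \<in> C"
    proof (rule ccontr)
      assume "z \<notin> C"
      then obtain f :: "'a \<Rightarrow>\<^sub>L real" and b where "(f, b) \<in> H" "b < f z"
        using separate_point_closed_convex[OF assms, of z] by (auto simp: H_def)
      then have "z \<in> \<Union>(U ` H)" unfolding U_def by (intro UN_I[of "(f, b)"]) simp_all
      then have "z \<in> \<Union>(U ` G)" using F(3) G(3) by simp
      then obtain h where h: "h \<in> G" "z \<in> U h" by blast
      have "h \<in> range g" using rg h(1) by simp
      then obtain k where "h = g k" by blast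
      then have "snd (g k) < fst (g k) z" using h(2) by (simp add: U_def split: prod.splits)
      then show False using le by (simp add: not_le[symmetric])
    qed
  qed
  then show ?thesis by (intro exI[of _ "\<lambda>k. fst (g k)"] exI[of _ "\<lambda>k. snd (g k)"]) auto
qed

text \<open>A functional bounded above on a cone is nonpositive there, and the offsets are
  nonnegative because 0 lies in \<open>K\<close>. So all offsets may be replaced by 0.\<close>

lemma closed_convex_cone_countable_halfspaces:
  fixes K :: "'a::{real_normed_vector, second_countable_topology} set"
  assumes "K \<noteq> {}" "convex K" "closed K" "cone K"
  shows "\<exists>f :: nat \<Rightarrow> 'a \<Rightarrow>\<^sub>L real. \<forall>z. z \<in> K \<longleftrightarrow> (\<forall>k. 0 \<le> f k z)"
proof -
  obtain f :: "nat \<Rightarrow> 'a \<Rightarrow>\<^sub>L real" and b where fb: "\<And>z. z \<in> K \<longleftrightarrow> (\<forall>k. f k z \<le> b k)"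
    using closed_convex_countable_halfspaces[OF assms(2,3)] by blast
  have "0 \<in> K" using assms(1) mem_cone[OF assms(4), of _ 0] by auto
  then have b0: "0 \<le> b k" for k using fb[of 0] by auto
  have neg: "f k z \<le> 0" if "z \<in> K" for k z
  proof (rule ccontr)
    assume "\<not> ?thesis"
    then have pos: "0 < f k z" by simp
    \<comment> \<open>The multiple of \<open>z\<close> at which \<open>f k\<close> takes the
      forbidden value \<open>b k + 1\<close>.\<close>
    define c where "c = (b k + 1) / f k z"
    have "c *\<^sub>R z \<in> K" using assms(4) that pos b0[of k] by (auto simp: c_def intro!: mem_cone)
    then have "f k (c *\<^sub>R z) \<le> b k" using fb by blast
    then show False using pos by (simp add: blinfun.scaleR_right c_def)
  qed
  have "z \<in> K \<longleftrightarrow> (\<forall>k. 0 \<le> (- f k) z)" for z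
    using neg[of z] b0 fb[of z] by (auto simp: blinfun.minus_left intro: order_trans)
  then show ?thesis by (intro exI[of _ "\<lambda>k. - f k"]) blast
qed

subsection \<open>Weak convergence and weak measurability\<close>

definition weakly_tendsto :: "(nat \<Rightarrow> 'a::real_normed_vector) \<Rightarrow> 'a \<Rightarrow> bool" where
  "weakly_tendsto y l \<longleftrightarrow> (\<forall>f :: 'a \<Rightarrow>\<^sub>L real. (\<lambda>n. f (y n)) \<longlonglongrightarrow> f l)"

lemma weakly_tendsto_in_closed_convex:
  assumes "weakly_tendsto y l" "convex C" "closed C" "\<And>n. y n \<in> C"
  shows "l \<in> C"
proof (rule ccontr)
  assume "l \<notin> C"
  then obtain f :: "'a \<Rightarrow>\<^sub>L real" and b where f: "\<And>z. z \<in> C \<Longrightarrow> f z \<le> b" "b < f l"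
    using separate_point_closed_convex[OF assms(2,3)] by blast
  have "(\<lambda>n. f (y n)) \<longlonglongrightarrow> f l" using assms(1) by (simp add: weakly_tendsto_def)
  then have "f l \<le> b" using f(1) assms(4) by (intro LIMSEQ_le_const2) auto
  then show False using f(2) by simp
qed

text \<open>The affine minorant that touches \<open>p\<close> at the limit \<open>l\<close>
  converges along \<open>y\<close>. The shift \<open>b\<close> and the passage to
  \<open>ennreal\<close> prepare Fatou's lemma.\<close>

lemma weakly_tendsto_convex_liminf:
  fixes p :: "'a::real_normed_vector \<Rightarrow> real"
  assumes "weakly_tendsto y l" "convex_on UNIV p" "continuous_on UNIV p"
  shows "ennreal (p l + b) \<le> liminf (\<lambda>n. ennreal (p (y n) + b))"
proof -
  have "isCont p l" using assms(3) by (simp add: continuous_on_eq_continuous_at)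
  then obtain f :: "'a \<Rightarrow>\<^sub>L real" where f: "\<And>z. p l + f (z - l) \<le> p z"
    using exists_subgradient[OF assms(2)] by blast
  have "(\<lambda>n. f (y n)) \<longlonglongrightarrow> f l" using assms(1) by (simp add: weakly_tendsto_def)
  then have "(\<lambda>n. p l + (f (y n) - f l) + b) \<longlonglongrightarrow> p l + (f l - f l) + b"
    by (intro tendsto_add tendsto_diff tendsto_const)
  then have "(\<lambda>n. ennreal (p l + (f (y n) - f l) + b)) \<longlonglongrightarrow> ennreal (p l + b)"
    by (intro tendsto_ennrealI) simp
  then have "ennreal (p l + b) = liminf (\<lambda>n. ennreal (p l + (f (y n) - f l) + b))"
    by (intro lim_imp_Liminf[symmetric]) auto
  also have "\<dots> \<le> liminf (\<lambda>n. ennreal (p (y n) + b))"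
    using f by (intro Liminf_mono always_eventually allI ennreal_leI) (simp add: blinfun.diff_right)
  finally show ?thesis .
qed

lemma reflexive_spaceE:
  fixes L :: "('a::real_normed_vector \<Rightarrow>\<^sub>L real) \<Rightarrow> real"
  assumes "reflexive_space TYPE('a)" "bounded_linear L"
  obtains x where "\<And>f. L f = blinfun_apply f x"
  using assms(1)[unfolded reflexive_space_def, rule_format, of "Blinfun L"]
  by (auto simp: bounded_linear_Blinfun_apply[OF assms(2)])

text \<open>The functionals along which \<open>y\<close> converges form a closed subspace
  \<open>V\<close>. Were it proper, a separating functional on the dual would, by reflexivity, be
  evaluation at a vector annihilated by every \<open>\<xi> k\<close>, hence at 0. So all functionals
  converge, and reflexivity represents the limit functional by a point.\<close>

lemma reflexive_weak_limit:
  fixes y :: "nat \<Rightarrow> 'a::real_normed_vector"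
  assumes refl: "reflexive_space TYPE('a)"
    and sep: "\<And>x. (\<And>k. blinfun_apply (\<xi> k) x = 0) \<Longrightarrow> x = (0::'a)"
    and bd: "\<And>n. norm (y n) \<le> R"
    and conv: "\<And>k. convergent (\<lambda>n. blinfun_apply (\<xi> k) (y n) :: real)"
  shows "\<exists>l. weakly_tendsto y l"
proof -
  define V where "V = {f :: 'a \<Rightarrow>\<^sub>L real. convergent (\<lambda>n. f (y n))}"
  have R: "0 \<le> R" using bd[of 0] norm_ge_zero order_trans by blast
  have absf: "\<bar>blinfun_apply f (y n)\<bar> \<le> norm f * R" for f :: "'a \<Rightarrow>\<^sub>L real" and n
    using norm_blinfun[of f "y n"] mult_left_mono[OF bd[of n], of "norm f"] by simp
  have cvxV: "convex V" unfolding convex_def V_def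
    by (auto simp: blinfun.add_left blinfun.scaleR_left intro!: convergent_add convergent_mult convergent_const)
  have clV: "closed V"
  proof (unfold closed_sequential_limits, intro allI impI, elim conjE)
    fix F f assume F: "\<forall>n. F n \<in> V" and lim: "F \<longlonglongrightarrow> f"
    have "Cauchy (\<lambda>n. f (y n))"
    proof (rule metric_CauchyI)
      fix e :: real assume e: "0 < e"
      \<comment> \<open>The summand 1 covers the case R = 0.\<close>
      define d where "d = e / (3 * (R + 1))"
      have d: "0 < d" using e R by (simp add: d_def)
      have dR: "d * R < e / 3" using e R by (simp add: d_def field_simps)
      obtain m where m: "norm (F m - f) < d"
        using LIMSEQ_D[OF lim d] by blast
      have close: "\<bar>F m (y n) - f (y n)\<bar> < e / 3" for n
      proof -
        have "\<bar>(F m - f) (y n)\<bar> \<le> norm (F m - f) * R" by (rule absf)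
        also have "\<dots> \<le> d * R" using m R by (intro mult_right_mono) auto
        finally show ?thesis using dR by (simp add: blinfun.diff_left)
      qed
      have "Cauchy (\<lambda>n. F m (y n))" using F by (simp add: V_def convergent_Cauchy)
      then obtain N where N: "\<And>j k. N \<le> j \<Longrightarrow> N \<le> k \<Longrightarrow> dist (F m (y j)) (F m (y k)) < e / 3"
        using metric_CauchyD[of _ "e / 3"] e by (metis divide_pos_pos zero_less_numeral)
      show "\<exists>N. \<forall>j\<ge>N. \<forall>k\<ge>N. dist (f (y j)) (f (y k)) < e"
      proof (intro exI allI impI)
        fix j k assume "N \<le> j" "N \<le> k"
        then show "dist (f (y j)) (f (y k)) < e"
          using N[of j k] close[of j] close[of k] unfolding dist_real_def by linarith
      qed
    qed
    then show "f \<in> V" by (simp add: V_def Cauchy_convergent_iff)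
  qed
  have all: "f \<in> V" for f
  proof (rule ccontr)
    assume "f \<notin> V"
    then obtain \<Phi> :: "('a \<Rightarrow>\<^sub>L real) \<Rightarrow>\<^sub>L real" and b where \<Phi>: "\<And>g. g \<in> V \<Longrightarrow> \<Phi> g \<le> b" "b < \<Phi> f"
      using separate_point_closed_convex[OF cvxV clV] by blast
    obtain x where x: "\<And>g. \<Phi> g = blinfun_apply g x"
      using refl unfolding reflexive_space_def by blast
    have "x = 0"
    proof (rule sep)
      fix k
      have "c * \<xi> k x \<le> b" for c
      proof -
        have "c *\<^sub>R \<xi> k \<in> V"
          using conv[of k] unfolding V_def by (auto simp: blinfun.scaleR_left intro!: convergent_mult convergent_const)
        then show ?thesis using \<Phi>(1) x by (metis blinfun.scaleR_left real_scaleR_def)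
      qed
      \<comment> \<open>All multiples of \<open>\<xi> k\<close> lie in \<open>V\<close>; the one
        chosen here would have value b + 1 at \<open>x\<close>.\<close>
      from this[of "(b + 1) / \<xi> k x"] show "\<xi> k x = 0" by (cases "\<xi> k x = 0") auto
    qed
    moreover have "(0 :: 'a \<Rightarrow>\<^sub>L real) \<in> V" by (simp add: V_def convergent_const)
    ultimately show False using \<Phi> x by (metis blinfun.zero_right not_le)
  qed
  define L where "L f = lim (\<lambda>n. blinfun_apply f (y n))" for f :: "'a \<Rightarrow>\<^sub>L real"
  have L: "(\<lambda>n. f (y n)) \<longlonglongrightarrow> L f" for f :: "'a \<Rightarrow>\<^sub>L real"
    using all[of f] by (simp add: V_def L_def convergent_LIMSEQ_iff)
  have "bounded_linear L"
  proof (rule bounded_linear_intro)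
    fix f g :: "'a \<Rightarrow>\<^sub>L real" and c :: real
    show "L (f + g) = L f + L g"
      using L[of "f + g"] tendsto_add[OF L[of f] L[of g]]
      unfolding blinfun.add_left by (rule LIMSEQ_unique)
    show "L (c *\<^sub>R f) = c *\<^sub>R L f"
      using L[of "c *\<^sub>R f"] tendsto_scaleR[OF tendsto_const[of c] L[of f]]
      unfolding blinfun.scaleR_left by (rule LIMSEQ_unique)
    have "norm (L f) \<le> norm f * R"
      using absf[of f] by (intro LIMSEQ_le_const2[OF tendsto_norm[OF L]]) auto
    then show "norm (L f) \<le> norm f * R" .
  qed
  then obtain l where "\<And>f. L f = blinfun_apply f l"
    using reflexive_spaceE[OF refl] by blast
  then show ?thesis using L unfolding weakly_tendsto_def by auto
qed

lemma blinfun_Pair_split: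
  fixes f :: "('a::real_normed_vector \<times> 'b::real_normed_vector) \<Rightarrow>\<^sub>L real"
  obtains f1 :: "'a \<Rightarrow>\<^sub>L real" and f2 :: "'b \<Rightarrow>\<^sub>L real" where "\<And>x y. f (x, y) = f1 x + f2 y"
proof
  have 1: "bounded_linear (\<lambda>x::'a. f (x, 0))"
    by (intro bounded_linear_compose[OF blinfun.bounded_linear_right] bounded_linear_Pair bounded_linear_ident bounded_linear_zero)
  have 2: "bounded_linear (\<lambda>y::'b. f (0, y))"
    by (intro bounded_linear_compose[OF blinfun.bounded_linear_right] bounded_linear_Pair bounded_linear_ident bounded_linear_zero)
  show "f (x, y) = Blinfun (\<lambda>x. f (x, 0)) x + Blinfun (\<lambda>y. f (0, y)) y" for x y
    by (simp add: bounded_linear_Blinfun_apply[OF 1] bounded_linear_Blinfun_apply[OF 2] blinfun.add_right[symmetric])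
qed

lemma reflexive_space_prod:
  assumes "reflexive_space TYPE('a::real_normed_vector)" "reflexive_space TYPE('b::real_normed_vector)"
  shows "reflexive_space TYPE('a \<times> 'b)"
  unfolding reflexive_space_def
proof
  fix \<Phi> :: "(('a \<times> 'b) \<Rightarrow>\<^sub>L real) \<Rightarrow>\<^sub>L real"
  define in1 :: "'a \<Rightarrow>\<^sub>L ('a \<times> 'b)" where "in1 = Blinfun (\<lambda>x. (x, 0))"
  define in2 :: "'b \<Rightarrow>\<^sub>L ('a \<times> 'b)" where "in2 = Blinfun (\<lambda>x. (0, x))"
  have in1: "in1 x = (x, 0)" for x unfolding in1_def
    by (subst bounded_linear_Blinfun_apply) (auto intro!: bounded_linear_Pair bounded_linear_ident bounded_linear_zero)
  have in2: "in2 x = (0, x)" for x unfolding in2_def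
    by (subst bounded_linear_Blinfun_apply) (auto intro!: bounded_linear_Pair bounded_linear_ident bounded_linear_zero)
  have bl1: "bounded_linear (\<lambda>g :: 'a \<Rightarrow>\<^sub>L real. \<Phi> (g o\<^sub>L fst_blinfun))"
    by (intro bounded_linear_compose[OF blinfun.bounded_linear_right]
          bounded_bilinear.bounded_linear_left[OF bounded_bilinear_blinfun_compose])
  have bl2: "bounded_linear (\<lambda>g :: 'b \<Rightarrow>\<^sub>L real. \<Phi> (g o\<^sub>L snd_blinfun))"
    by (intro bounded_linear_compose[OF blinfun.bounded_linear_right]
          bounded_bilinear.bounded_linear_left[OF bounded_bilinear_blinfun_compose])
  obtain x1 where x1: "\<And>g :: 'a \<Rightarrow>\<^sub>L real. \<Phi> (g o\<^sub>L fst_blinfun) = g x1"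
    using reflexive_spaceE[OF assms(1) bl1] by blast
  obtain x2 where x2: "\<And>g :: 'b \<Rightarrow>\<^sub>L real. \<Phi> (g o\<^sub>L snd_blinfun) = g x2"
    using reflexive_spaceE[OF assms(2) bl2] by blast
  show "\<exists>x. \<forall>f. \<Phi> f = blinfun_apply f x"
  proof (intro exI allI)
    fix f :: "('a \<times> 'b) \<Rightarrow>\<^sub>L real"
    have eq: "f = ((f o\<^sub>L in1) o\<^sub>L fst_blinfun) + ((f o\<^sub>L in2) o\<^sub>L snd_blinfun)"
      by (rule blinfun_eqI) (auto simp: blinfun.add_left in1 in2 blinfun.add_right[symmetric])
    have "\<Phi> f = \<Phi> ((f o\<^sub>L in1) o\<^sub>L fst_blinfun) + \<Phi> ((f o\<^sub>L in2) o\<^sub>L snd_blinfun)"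
      by (subst eq) (rule blinfun.add_right)
    also have "\<dots> = f (x1, x2)"
      by (simp only: x1 x2) (simp add: in1 in2 blinfun.add_right[symmetric])
    finally show "\<Phi> f = blinfun_apply f (x1, x2)" .
  qed
qed

section \<open>Measurability of vector-valued functions\<close>

text \<open>Pettis' theorem: countably many half-spaces make preimages of closed convex sets
  measurable, and by the Lindelof property every open set is a countable union of closed
  balls.\<close>

lemma weakly_measurable_imp_borel_measurable:
  fixes y :: "'o \<Rightarrow> 'a::{real_normed_vector, second_countable_topology}"
  assumes meas: "\<And>f :: 'a \<Rightarrow>\<^sub>L real. (\<lambda>\<omega>. f (y \<omega>)) \<in> borel_measurable M"
  shows "y \<in> borel_measurable M"
proof (rule borel_measurableI)
  fix U :: "'a set" assume "open U"
  have cc: "y -` C \<inter> space M \<in> sets M" if C: "convex C" "closed C" for C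
  proof -
    obtain f :: "nat \<Rightarrow> 'a \<Rightarrow>\<^sub>L real" and b where fb: "\<And>z. z \<in> C \<longleftrightarrow> (\<forall>k. f k z \<le> b k)"
      using closed_convex_countable_halfspaces[OF C] by blast
    have "y -` C \<inter> space M = {\<omega>\<in>space M. \<forall>k. f k (y \<omega>) \<le> b k}" using fb by auto
    also have "\<dots> \<in> sets M" using meas by measurable
    finally show ?thesis .
  qed
  define H where "H = {(x, r). cball x r \<subseteq> U}"
  define B where "B = (\<lambda>(x::'a, r). ball x r)"
  have op: "open S" if "S \<in> B ` H" for S using that by (auto simp: B_def)
  obtain F where F: "F \<subseteq> B ` H" "countable F" "\<Union>F = \<Union>(B ` H)"
    using Lindelof[OF op] by auto
  have "\<exists>G. countable G \<and> G \<subseteq> H \<and> F = B ` G"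
    using countable_subset_image[of F B H] F(1,2) by blast
  then obtain G where G: "G \<subseteq> H" "countable G" "F = B ` G" by blast
  have "U = (\<Union>(x, r)\<in>G. cball x r)"
  proof
    show "U \<subseteq> (\<Union>(x, r)\<in>G. cball x r)"
    proof
      fix x assume "x \<in> U"
      then obtain r where r: "0 < r" "cball x r \<subseteq> U" using \<open>open U\<close> open_contains_cball by blast
      then have "x \<in> B (x, r)" "(x, r) \<in> H" by (auto simp: B_def H_def)
      then have "x \<in> \<Union>(B ` H)" by blast
      then have "x \<in> \<Union>(B ` G)" using F(3) G(3) by simp
      then obtain h where "h \<in> G" "x \<in> B h" by blast
      then show "x \<in> (\<Union>(x, r)\<in>G. cball x r)"
        by (intro UN_I[of h]) (auto simp: B_def split: prod.splits)
    qed
    show "(\<Union>(x, r)\<in>G. cball x r) \<subseteq> U" using G(1) by (auto simp: H_def)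
  qed
  then have "y -` U \<inter> space M = (\<Union>h\<in>G. y -` (cball (fst h) (snd h)) \<inter> space M)"
    unfolding case_prod_beta' by blast
  also have "\<dots> \<in> sets M" using G(2) cc by (intro sets.countable_UN') auto
  finally show "y -` U \<inter> space M \<in> sets M" .
qed

text \<open>This serves for limits that exist or are chosen only almost everywhere; completeness
  absorbs their values on the null set.\<close>

lemma (in complete_measure) borel_measurable_AE_cong:
  assumes g: "g \<in> borel_measurable M" and ae: "AE x in M. f x = g x"
  shows "f \<in> borel_measurable M"
proof (rule measurableI)
  fix A :: "'b set" assume A: "A \<in> sets borel"
  obtain N where N: "{x\<in>space M. f x \<noteq> g x} \<subseteq> N" "N \<in> null_sets M"
    using ae by (auto elim!: AE_E simp: null_sets_def)
  have "f -` A \<inter> N \<inter> space M \<in> sets M"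
    using N(2) by (intro complete[of _ N]) auto
  moreover have "g -` A \<inter> space M - N \<in> sets M"
    using g A N by (auto intro!: sets.Diff measurable_sets)
  moreover have "f -` A \<inter> space M = (f -` A \<inter> N \<inter> space M) \<union> (g -` A \<inter> space M - N)"
    using N by auto
  ultimately show "f -` A \<inter> space M \<in> sets M" by simp
qed simp

lemma borel_measurable_imp_strongly_measurable:
  fixes f :: "'o \<Rightarrow> 'a::{real_normed_vector, second_countable_topology}"
  assumes "f \<in> borel_measurable M"
  shows "strongly_measurable M f"
  using borel_measurable_implies_sequence_metric[OF assms, of 0]
  unfolding strongly_measurable_def by (auto intro!: AE_I2)

lemma (in complete_measure) strongly_measurable_imp_borel_measurable:
  fixes f :: "'a \<Rightarrow> 'b::{banach, second_countable_topology}"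
  assumes "strongly_measurable M f"
  shows "f \<in> borel_measurable M"
proof -
  obtain s where s: "\<And>n::nat. simple_function M (s n)" "AE \<omega> in M. (\<lambda>n. s n \<omega>) \<longlonglongrightarrow> f \<omega>"
    using assms unfolding strongly_measurable_def by blast
  have [measurable]: "s n \<in> borel_measurable M" for n
    using s(1) by (rule borel_measurable_simple_function)
  have "(\<lambda>\<omega>. lim (\<lambda>n. s n \<omega>)) \<in> borel_measurable M" by measurable
  moreover have "AE \<omega> in M. f \<omega> = lim (\<lambda>n. s n \<omega>)" using s(2) by eventually_elim (simp add: limI)
  ultimately show ?thesis by (rule borel_measurable_AE_cong)
qed

text \<open>Along a simple approximation of \<open>g\<close> only finitely many sections
  \<open>F y\<close> occur, and continuity in \<open>y\<close> passes to the limit.\<close>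

lemma caratheodory_measurable:
  fixes F :: "'a::{real_normed_vector, second_countable_topology} \<Rightarrow> 'o \<Rightarrow> 'b::metric_space"
  assumes cont: "\<And>\<omega>. \<omega> \<in> space M \<Longrightarrow> continuous_on UNIV (\<lambda>y. F y \<omega>)"
    and meas: "\<And>y. F y \<in> borel_measurable M"
    and g: "g \<in> borel_measurable M"
  shows "(\<lambda>\<omega>. F (g \<omega>) \<omega>) \<in> borel_measurable M"
proof -
  obtain s where s: "\<And>i. simple_function M (s i)" "\<And>x. x \<in> space M \<Longrightarrow> (\<lambda>i. s i x) \<longlonglongrightarrow> g x"
    using borel_measurable_implies_sequence_metric[OF g, of 0] by auto
  show ?thesis
  proof (rule borel_measurable_LIMSEQ_metric)
    fix i
    show "(\<lambda>\<omega>. F (s i \<omega>) \<omega>) \<in> borel_measurable M"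
    proof (rule measurable_compose_countable'[where f="\<lambda>y. F y" and I="s i ` space M"])
      show "s i \<in> measurable M (count_space (s i ` space M))"
        using simple_functionD[OF s(1)[of i]] by (auto simp: measurable_count_space_eq2)
      show "countable (s i ` space M)"
        using simple_functionD(1)[OF s(1)[of i]] by (rule countable_finite)
    qed (rule meas)
  next
    fix \<omega> assume \<omega>: "\<omega> \<in> space M"
    show "(\<lambda>i. F (s i \<omega>) \<omega>) \<longlonglongrightarrow> F (g \<omega>) \<omega>"
      using cont[OF \<omega>] s(2)[OF \<omega>] by (rule continuous_on_tendsto_compose) auto
  qed
qed

subsection \<open>Selection of a pointwise weakly convergent sequence\<close>

text \<open>Near-minimizers of one quadratic energy are chosen in ever smaller sets. The midpoint of
  two consecutive choices still lies in a set of the family, so its energy cannot be much smaller,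
  and the parallelogram law makes their difference small. Membership of the limit \<open>l\<close>
  in the sets is left to semicontinuity arguments.\<close>

lemma (in prob_space) weak_pointwise_selection:
  fixes A :: "nat \<Rightarrow> ('a \<Rightarrow> 'b::{real_normed_vector, second_countable_topology}) set"
  assumes complete: "complete_measure M"
    and refl: "reflexive_space TYPE('b)"
    and meas: "\<And>m g. g \<in> A m \<Longrightarrow> g \<in> borel_measurable M"
    and bd: "\<And>m g. g \<in> A m \<Longrightarrow> AE \<omega> in M. norm (g \<omega>) \<le> R"
    and ne: "\<And>m. A m \<noteq> {}"
    and dec: "decseq A"
    and mid: "\<And>m f g. f \<in> A m \<Longrightarrow> g \<in> A m \<Longrightarrow> (\<lambda>\<omega>. (1/2) *\<^sub>R f \<omega> + (1/2) *\<^sub>R g \<omega>) \<in> A m"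
  shows "\<exists>g l. (\<forall>m. g m \<in> A m) \<and> l \<in> borel_measurable M \<and>
    (AE \<omega> in M. weakly_tendsto (\<lambda>m. g m \<omega>) (l \<omega>))"
proof -
  interpret complete_measure M by (rule complete)
  obtain \<xi> :: "nat \<Rightarrow> 'b \<Rightarrow>\<^sub>L real" where \<xi>: "\<And>z. z \<in> {0} \<longleftrightarrow> (\<forall>k. 0 \<le> \<xi> k z)"
    using closed_convex_cone_countable_halfspaces[of "{0::'b}"] by (auto simp: cone_def)
  \<comment> \<open>The scaling gives norm at most 2^-k; the summand 1 guards against a zero
    functional.\<close>
  define \<eta> where "\<eta> k = (1 / (2 ^ k * (1 + norm (\<xi> k)))) *\<^sub>R \<xi> k" for k
  have np: "0 < 1 + norm (\<xi> k)" for k by (rule add_pos_nonneg) auto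
  have sep: "x = 0" if "\<And>k. \<eta> k x = 0" for x
  proof -
    have "\<xi> k x = 0" for k using that[of k] np[of k] by (auto simp: \<eta>_def blinfun.scaleR_left)
    then show ?thesis using \<xi>[of x] by auto
  qed
  have norm\<eta>: "norm (\<eta> k) \<le> (1/2) ^ k" for k
  proof -
    have "norm (\<eta> k) = (1/2) ^ k * (norm (\<xi> k) / (1 + norm (\<xi> k)))"
      using np[of k] by (simp add: \<eta>_def power_divide)
    also have "\<dots> \<le> (1/2) ^ k * 1" using np[of k] by (intro mult_left_mono) auto
    finally show ?thesis by simp
  qed
  have sq: "(\<eta> k y)\<^sup>2 \<le> (1/4) ^ k * (norm y)\<^sup>2" for k y
  proof -
    have "\<bar>\<eta> k y\<bar> \<le> norm (\<eta> k) * norm y" using norm_blinfun[of "\<eta> k" y] by simp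
    also have "\<dots> \<le> (1/2) ^ k * norm y" using norm\<eta> by (intro mult_right_mono) auto
    finally have "\<bar>\<eta> k y\<bar>\<^sup>2 \<le> ((1/2) ^ k * norm y)\<^sup>2" by (intro power_mono) auto
    also have "((1/2) ^ k * norm y)\<^sup>2 = (1/4) ^ k * (norm y)\<^sup>2"
      by (simp add: power_mult_distrib power2_eq_square power_mult_distrib[symmetric])
    finally show ?thesis by simp
  qed
  have sumG: "summable (\<lambda>k. (1/4) ^ k * (norm y)\<^sup>2)" for y :: 'b
    by (intro summable_mult2 summable_geometric) auto
  have summ: "summable (\<lambda>k. (\<eta> k y)\<^sup>2)" for y
    by (rule summable_comparison_test'[OF sumG[of y], of 0]) (use sq in auto)
  \<comment> \<open>The square of a Hilbertian norm weaker than the given one; the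
    \<open>\<eta> k\<close> are its coordinates.\<close>
  define h where "h y = (\<Sum>k. (\<eta> k y)\<^sup>2)" for y
  have h0: "0 \<le> h y" for y unfolding h_def by (intro suminf_nonneg summ) auto
  have hk: "(\<eta> k y)\<^sup>2 \<le> h y" for k y
    unfolding h_def using sum_le_suminf[OF summ[of y], of "{k}"] by auto
  \<comment> \<open>The constant 4/3 is the sum of the series (1/4)^k.\<close>
  have hle: "h y \<le> 4/3 * (norm y)\<^sup>2" for y
  proof -
    have "h y \<le> (\<Sum>k. (1/4) ^ k * (norm y)\<^sup>2)" unfolding h_def by (intro suminf_le sq summ sumG)
    also have "\<dots> = 4/3 * (norm y)\<^sup>2"
      by (subst suminf_mult2[symmetric]) (auto simp: suminf_geometric)
    finally show ?thesis .
  qed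
  have par: "h ((1/2) *\<^sub>R a + (1/2) *\<^sub>R b) = h a / 2 + h b / 2 - h (a - b) / 4" for a b
  proof -
    have "h ((1/2) *\<^sub>R a + (1/2) *\<^sub>R b) = (\<Sum>k. (\<eta> k a)\<^sup>2 / 2 + (\<eta> k b)\<^sup>2 / 2 - (\<eta> k (a - b))\<^sup>2 / 4)"
      unfolding h_def
      by (intro suminf_cong) (simp add: blinfun.add_right blinfun.scaleR_right blinfun.diff_right power2_eq_square field_simps)
    also have "\<dots> = (\<Sum>k. (\<eta> k a)\<^sup>2 / 2 + (\<eta> k b)\<^sup>2 / 2) - (\<Sum>k. (\<eta> k (a - b))\<^sup>2 / 4)"
      by (intro suminf_diff[symmetric] summable_add summable_divide summ)
    also have "(\<Sum>k. (\<eta> k a)\<^sup>2 / 2 + (\<eta> k b)\<^sup>2 / 2) = (\<Sum>k. (\<eta> k a)\<^sup>2 / 2) + (\<Sum>k. (\<eta> k b)\<^sup>2 / 2)"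
      by (intro suminf_add[symmetric] summable_divide summ)
    finally show ?thesis unfolding h_def by (simp add: suminf_divide summ)
  qed
  have hmeas: "(\<lambda>\<omega>. h (g \<omega>)) \<in> borel_measurable M" if [measurable]: "g \<in> borel_measurable M" for g
  proof -
    have [measurable]: "(\<lambda>\<omega>. \<eta> k (g \<omega>)) \<in> borel_measurable M" for k
      by (intro borel_measurable_continuous_on[OF _ that] continuous_intros)
    show ?thesis unfolding h_def by measurable
  qed
  have hint: "integrable M (\<lambda>\<omega>. h (g \<omega>))" if g: "g \<in> borel_measurable M" "AE \<omega> in M. norm (g \<omega>) \<le> B" for g B
  proof (rule integrable_const_bound)
    show "AE \<omega> in M. norm (h (g \<omega>)) \<le> 4/3 * B\<^sup>2"
      using g(2)
    proof eventually_elim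
      case (elim \<omega>)
      have "h (g \<omega>) \<le> 4/3 * (norm (g \<omega>))\<^sup>2" by (rule hle)
      also have "\<dots> \<le> 4/3 * B\<^sup>2" using elim by (intro mult_left_mono power_mono) auto
      finally show ?case using h0 by simp
    qed
  qed (rule hmeas[OF g(1)])
  define q where "q g = (\<integral>\<omega>. h (g \<omega>) \<partial>M)" for g
  have q0: "0 \<le> q g" for g unfolding q_def using h0 by (intro integral_nonneg_AE) auto
  have qle: "q g \<le> 4/3 * R\<^sup>2" if "g \<in> A m" for g m
  proof -
    have "q g \<le> (\<integral>\<omega>. 4/3 * R\<^sup>2 \<partial>M)" unfolding q_def
    proof (rule integral_mono_AE)
      show "AE \<omega> in M. h (g \<omega>) \<le> 4/3 * R\<^sup>2"
        using bd[OF that]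
      proof eventually_elim
        case (elim \<omega>)
        then have "(norm (g \<omega>))\<^sup>2 \<le> R\<^sup>2" by (intro power_mono) auto
        then show ?case using hle[of "g \<omega>"] by linarith
      qed
    qed (use hint[OF meas[OF that] bd[OF that]] in auto)
    then show ?thesis by (simp add: prob_space)
  qed
  define s where "s m = Inf (q ` A m)" for m
  have sle: "s m \<le> q g" if "g \<in> A m" for m g
    unfolding s_def using that q0 by (intro cInf_lower bdd_belowI[of _ 0]) auto
  have sub: "A n \<subseteq> A m" if "m \<le> n" for m n using dec that by (auto simp: decseq_def)
  have "incseq s"
  proof (rule incseq_SucI)
    fix m show "s m \<le> s (Suc m)" unfolding s_def
      using ne q0 sub[of m "Suc m"] by (intro cInf_superset_mono) (auto intro!: bdd_belowI[of _ 0])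
  qed
  moreover have sbd: "s m \<le> 4/3 * R\<^sup>2" for m
  proof -
    obtain g where "g \<in> A m" using ne by blast
    then show ?thesis using sle qle by (meson order_trans)
  qed
  ultimately obtain S where S: "s \<longlonglongrightarrow> S" and sS: "\<And>m. s m \<le> S"
    using incseq_convergent[of s] by blast
  \<comment> \<open>The rate 1/8 leaves a series of ratio 1/2 after multiplication by the weight 4^m
    used further on.\<close>
  have "\<exists>N\<ge>m. S - s N \<le> (1/8) ^ m" for m
  proof -
    have "eventually (\<lambda>n. dist (s n) S < (1/8) ^ m) sequentially"
      by (rule tendstoD[OF S]) auto
    then have "eventually (\<lambda>n. m \<le> n \<and> dist (s n) S < (1/8) ^ m) sequentially"
      using eventually_ge_at_top by (rule eventually_conj[rotated])
    then obtain n where "m \<le> n" "dist (s n) S < (1/8) ^ m"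
      using eventually_happens'[OF sequentially_bot] by blast
    then show ?thesis using sS[of n] by (intro exI[of _ n]) (auto simp: dist_real_def)
  qed
  then obtain N where N: "\<And>m. m \<le> N m" "\<And>m. S - s (N m) \<le> (1/8) ^ m" by metis
  have "\<exists>g\<in>A (N m). q g < s (N m) + (1/8) ^ m" for m
    using cInf_lessD[of "q ` A (N m)" "s (N m) + (1/8) ^ m"] ne by (auto simp: s_def)
  then obtain g where g: "\<And>m. g m \<in> A (N m)" "\<And>m. q (g m) < s (N m) + (1/8) ^ m" by metis
  have gA: "g m \<in> A m" for m using g(1) sub[OF N(1)] by blast
  note gm = meas[OF gA] and gb = bd[OF gA]
  define d where "d m \<omega> = g m \<omega> - g (Suc m) \<omega>" for m \<omega>
  have dm: "d m \<in> borel_measurable M" for m unfolding d_def using gm by measurable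
  have db: "AE \<omega> in M. norm (d m \<omega>) \<le> R + R" for m
    using gb[of m] gb[of "Suc m"]
    by eventually_elim (auto simp: d_def intro!: norm_triangle_le_diff)
  have qd: "q (d m) \<le> 8 * (1/8) ^ m" for m
  proof -
    \<comment> \<open>\<open>N\<close> need not be monotone, so the smaller index is the one whose
      set contains both functions.\<close>
    define n where "n = min (N m) (N (Suc m))"
    define f where "f \<omega> = (1/2) *\<^sub>R g m \<omega> + (1/2) *\<^sub>R g (Suc m) \<omega>" for \<omega>
    have "g m \<in> A n" "g (Suc m) \<in> A n" using g(1) sub[of n "N m"] sub[of n "N (Suc m)"] by (auto simp: n_def)
    then have fA: "f \<in> A n" using mid unfolding f_def by blast
    have p8: "(1/8::real) ^ Suc m \<le> (1/8) ^ m" by simp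
    have "S - s n \<le> (1/8) ^ m"
      using N(2)[of m] order_trans[OF N(2)[of "Suc m"] p8] by (simp add: n_def min_def)
    then have lo: "S - (1/8) ^ m \<le> q f" using sle[OF fA] by simp
    have hi: "q (g m) \<le> S + (1/8) ^ m" "q (g (Suc m)) \<le> S + (1/8) ^ m"
      using g(2)[of m] g(2)[of "Suc m"] sS[of "N m"] sS[of "N (Suc m)"] p8 by linarith+
    \<comment> \<open>With c = (1/8)^m this yields q (d m) \<le> 4 (S + c) - 4 (S - c) = 8
      c.\<close>
    have "q f = q (g m) / 2 + q (g (Suc m)) / 2 - q (d m) / 4"
      unfolding q_def f_def par d_def
      using hint[OF gm gb, of m] hint[OF gm gb, of "Suc m"] hint[OF dm db, of m] by (simp add: d_def)
    then show ?thesis using lo hi by simp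
  qed
  have "(\<integral>\<^sup>+\<omega>. (\<Sum>m. ennreal (4 ^ m * h (d m \<omega>))) \<partial>M) = (\<Sum>m. \<integral>\<^sup>+\<omega>. ennreal (4 ^ m * h (d m \<omega>)) \<partial>M)"
    using hmeas[OF dm] by (intro nn_integral_suminf) measurable
  also have "\<dots> \<le> (\<Sum>m. ennreal (8 * (1/2) ^ m))"
  proof (intro suminf_le summableI)
    fix m
    have "(\<integral>\<^sup>+\<omega>. ennreal (4 ^ m * h (d m \<omega>)) \<partial>M) = ennreal (\<integral>\<omega>. 4 ^ m * h (d m \<omega>) \<partial>M)"
      using hint[OF dm db, of m] h0 by (intro nn_integral_eq_integral) auto
    also have "\<dots> = ennreal (4 ^ m * q (d m))" by (simp add: q_def)
    also have "\<dots> \<le> ennreal (4 ^ m * (8 * (1/8) ^ m))" using qd by (intro ennreal_leI mult_left_mono) auto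
    also have "4 ^ m * (8 * (1/8) ^ m) = 8 * (1/2::real) ^ m"
      by (simp add: power_mult_distrib[symmetric])
    finally show "(\<integral>\<^sup>+\<omega>. ennreal (4 ^ m * h (d m \<omega>)) \<partial>M) \<le> ennreal (8 * (1/2) ^ m)" .
  qed
  also have "\<dots> = ennreal (\<Sum>m. 8 * (1/2) ^ m)"
    by (intro suminf_ennreal2 summable_mult summable_geometric) auto
  also have "\<dots> < \<infinity>" by simp
  finally have fin: "(\<integral>\<^sup>+\<omega>. (\<Sum>m. ennreal (4 ^ m * h (d m \<omega>))) \<partial>M) < \<infinity>" .
  have "AE \<omega> in M. (\<Sum>m. ennreal (4 ^ m * h (d m \<omega>))) \<noteq> \<infinity>"
    using hmeas[OF dm] by (intro nn_integral_PInf_AE[OF _ less_imp_neq[OF fin]]) measurable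
  moreover have "AE \<omega> in M. \<forall>m. norm (g m \<omega>) \<le> R" using gb by (simp add: AE_all_countable)
  ultimately have wl: "AE \<omega> in M. \<exists>l. weakly_tendsto (\<lambda>m. g m \<omega>) l"
  proof eventually_elim
    case (elim \<omega>)
    define C where "C = enn2real (\<Sum>m. ennreal (4 ^ m * h (d m \<omega>)))"
    have hC: "4 ^ m * h (d m \<omega>) \<le> C" for m
    proof -
      have "ennreal (4 ^ m * h (d m \<omega>)) \<le> (\<Sum>m. ennreal (4 ^ m * h (d m \<omega>)))"
        using sum_le_suminf[of "\<lambda>m. ennreal (4 ^ m * h (d m \<omega>))" "{m}"] by simp
      also have "\<dots> = ennreal C" unfolding C_def using elim(1) by (simp add: less_top)
      finally show ?thesis using h0[of "d m \<omega>"] by (subst (asm) ennreal_le_iff) (auto simp: C_def)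
    qed
    have C0: "0 \<le> C" by (simp add: C_def)
    have conv: "convergent (\<lambda>m. \<eta> k (g m \<omega>))" for k
    proof -
      \<comment> \<open>The weight 4^m bounds the increments by \<open>sqrt C * (1/2) ^ m\<close>,
        so they are summable and the entire sequence converges in each coordinate.\<close>
      have "summable (\<lambda>m. \<eta> k (g (Suc m) \<omega>) - \<eta> k (g m \<omega>))"
      proof (rule summable_comparison_test'[where N=0])
        show "summable (\<lambda>m. sqrt C * (1/2) ^ m)" by (intro summable_mult summable_geometric) auto
        fix m
        have "(4 ^ m) * (\<eta> k (d m \<omega>))\<^sup>2 \<le> 4 ^ m * h (d m \<omega>)" using hk by (intro mult_left_mono) auto
        also have "\<dots> \<le> C" by (rule hC)
        also have "(4 ^ m) * (\<eta> k (d m \<omega>))\<^sup>2 = (2 ^ m * \<bar>\<eta> k (d m \<omega>)\<bar>)\<^sup>2"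
        proof -
          have "(4::real) ^ m = (2 ^ m)\<^sup>2" by (simp add: power2_eq_square power_mult_distrib[symmetric])
          then show ?thesis by (simp add: power_mult_distrib)
        qed
        finally have "(2 ^ m * \<bar>\<eta> k (d m \<omega>)\<bar>)\<^sup>2 \<le> C" .
        then have "2 ^ m * \<bar>\<eta> k (d m \<omega>)\<bar> \<le> sqrt C" by (rule real_le_rsqrt)
        then have "\<bar>\<eta> k (d m \<omega>)\<bar> \<le> sqrt C * (1/2) ^ m" by (simp add: field_simps power_divide)
        then show "norm (\<eta> k (g (Suc m) \<omega>) - \<eta> k (g m \<omega>)) \<le> sqrt C * (1/2) ^ m"
          by (simp add: d_def blinfun.diff_right abs_minus_commute)
      qed
      then have "convergent (\<lambda>n. (\<Sum>m<n. \<eta> k (g (Suc m) \<omega>) - \<eta> k (g m \<omega>)) + \<eta> k (g 0 \<omega>))"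
        by (intro convergent_add convergent_const) (simp add: summable_iff_convergent)
      then show ?thesis by (simp add: sum_lessThan_telescope[where f="\<lambda>m. \<eta> k (g m \<omega>)"])
    qed
    show ?case by (rule reflexive_weak_limit[OF refl sep, where R=R]) (use elim conv in auto)
  qed
  define l where "l \<omega> = (SOME l. weakly_tendsto (\<lambda>m. g m \<omega>) l)" for \<omega>
  have wl: "AE \<omega> in M. weakly_tendsto (\<lambda>m. g m \<omega>) (l \<omega>)"
    using wl unfolding l_def by eventually_elim (rule someI_ex)
  moreover have "l \<in> borel_measurable M"
  proof (rule weakly_measurable_imp_borel_measurable)
    fix f :: "'b \<Rightarrow>\<^sub>L real"
    have "(\<lambda>\<omega>. f (g m \<omega>)) \<in> borel_measurable M" for m
      by (intro borel_measurable_continuous_on[OF _ gm] continuous_intros)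
    then have "(\<lambda>\<omega>. lim (\<lambda>m. f (g m \<omega>))) \<in> borel_measurable M" by measurable
    moreover have "AE \<omega> in M. f (l \<omega>) = lim (\<lambda>m. f (g m \<omega>))"
      using wl by eventually_elim (auto simp: weakly_tendsto_def intro!: limI[symmetric])
    ultimately show "(\<lambda>\<omega>. f (l \<omega>)) \<in> borel_measurable M" by (rule borel_measurable_AE_cong)
  qed
  ultimately show ?thesis using gA by blast
qed

subsection \<open>Minimization of convex integral functionals\<close>

locale two_stage = prob_space M for M :: "'o measure" +
  fixes C1 :: "'x1::{real_normed_vector, second_countable_topology} set"
    and C2 :: "'x2::{real_normed_vector, second_countable_topology} set"
  assumes complete: "complete_measure M"
    and refl: "reflexive_space TYPE('x1 \<times> 'x2)"
    and C1: "C1 \<noteq> {}" "convex C1" "closed C1" "bounded C1"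
    and C2: "C2 \<noteq> {}" "convex C2" "closed C2" "bounded C2"
begin

text \<open>A pair \<open>(x1, x2)\<close> is encoded by the function \<open>\<lambda>\<omega>. (x1, x2 \<omega>)\<close>.\<close>

definition decisions :: "('o \<Rightarrow> 'x1 \<times> 'x2) set" where
  "decisions = {y \<in> borel_measurable M. (\<exists>x. \<forall>\<omega>. fst (y \<omega>) = x) \<and> (AE \<omega> in M. y \<omega> \<in> C1 \<times> C2)}"

text \<open>The lower bound is uniform in \<omega>, so that a single shift makes Fatou's lemma
  applicable. Integrability along every decision excludes the default value 0 of the
  integral.\<close>

definition convex_integrand :: "('x1 \<times> 'x2 \<Rightarrow> 'o \<Rightarrow> real) \<Rightarrow> bool" where
  "convex_integrand F \<longleftrightarrow>
     (\<forall>\<omega>\<in>space M. convex_on UNIV (\<lambda>y. F y \<omega>) \<and> continuous_on UNIV (\<lambda>y. F y \<omega>)) \<and>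
     (\<exists>b. \<forall>\<omega>\<in>space M. \<forall>y\<in>C1 \<times> C2. - b \<le> F y \<omega>) \<and>
     (\<forall>y\<in>decisions. integrable M (\<lambda>\<omega>. F (y \<omega>) \<omega>))"

definition expected :: "('x1 \<times> 'x2 \<Rightarrow> 'o \<Rightarrow> real) \<Rightarrow> ('o \<Rightarrow> 'x1 \<times> 'x2) \<Rightarrow> real" where
  "expected F y = (\<integral>\<omega>. F (y \<omega>) \<omega> \<partial>M)"

lemma decisions_measurable: "y \<in> decisions \<Longrightarrow> y \<in> borel_measurable M"
  and decisions_AE: "y \<in> decisions \<Longrightarrow> AE \<omega> in M. y \<omega> \<in> C1 \<times> C2"
  by (auto simp: decisions_def)

lemma decisions_nonempty: "decisions \<noteq> {}"
proof -
  obtain x1 x2 where "x1 \<in> C1" "x2 \<in> C2" using C1 C2 by blast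
  then have "(\<lambda>_. (x1, x2)) \<in> decisions" by (auto simp: decisions_def)
  then show ?thesis by blast
qed

lemma decisions_bounded: "\<exists>R. \<forall>y\<in>decisions. AE \<omega> in M. norm (y \<omega>) \<le> R"
proof -
  obtain R where R: "\<And>y. y \<in> C1 \<times> C2 \<Longrightarrow> norm y \<le> R"
    using bounded_Times[OF C1(4) C2(4)] by (auto simp: bounded_iff)
  have "AE \<omega> in M. norm (y \<omega>) \<le> R" if "y \<in> decisions" for y
    using decisions_AE[OF that] by eventually_elim (rule R)
  then show ?thesis by blast
qed

lemma decisions_convex:
  assumes y: "y \<in> decisions" and z: "z \<in> decisions" and t: "0 \<le> t" "0 \<le> s" "s + t = 1"
  shows "(\<lambda>\<omega>. s *\<^sub>R y \<omega> + t *\<^sub>R z \<omega>) \<in> decisions"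
proof -
  have [measurable]: "y \<in> borel_measurable M" "z \<in> borel_measurable M"
    using y z by (auto dest: decisions_measurable)
  obtain a b where "\<And>\<omega>. fst (y \<omega>) = a" "\<And>\<omega>. fst (z \<omega>) = b" using y z unfolding decisions_def by blast
  then have "\<exists>x. \<forall>\<omega>. fst (s *\<^sub>R y \<omega> + t *\<^sub>R z \<omega>) = x" by auto
  moreover have "AE \<omega> in M. s *\<^sub>R y \<omega> + t *\<^sub>R z \<omega> \<in> C1 \<times> C2"
    using decisions_AE[OF y] decisions_AE[OF z]
    by eventually_elim (use convex_Times[OF C1(2) C2(2)] t in \<open>auto intro!: convexD\<close>)
  moreover have "(\<lambda>\<omega>. s *\<^sub>R y \<omega> + t *\<^sub>R z \<omega>) \<in> borel_measurable M" by measurable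
  ultimately show ?thesis unfolding decisions_def by blast
qed

lemma expected_convex:
  assumes F: "convex_integrand F" and y: "y \<in> decisions" and z: "z \<in> decisions"
    and t: "0 \<le> t" "0 \<le> s" "s + t = 1"
  shows "expected F (\<lambda>\<omega>. s *\<^sub>R y \<omega> + t *\<^sub>R z \<omega>) \<le> s * expected F y + t * expected F z"
proof -
  have int: "integrable M (\<lambda>\<omega>. F (y \<omega>) \<omega>)" if "y \<in> decisions" for y
    using F that by (auto simp: convex_integrand_def)
  have "expected F (\<lambda>\<omega>. s *\<^sub>R y \<omega> + t *\<^sub>R z \<omega>) \<le> (\<integral>\<omega>. s * F (y \<omega>) \<omega> + t * F (z \<omega>) \<omega> \<partial>M)"
    unfolding expected_def
  proof (rule integral_mono)
    fix \<omega> assume "\<omega> \<in> space M"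
    then have "convex_on UNIV (\<lambda>y. F y \<omega>)" using F by (auto simp: convex_integrand_def)
    from convex_onD[OF this, of t "y \<omega>" "z \<omega>"] t
    have "F ((1 - t) *\<^sub>R y \<omega> + t *\<^sub>R z \<omega>) \<omega> \<le> (1 - t) * F (y \<omega>) \<omega> + t * F (z \<omega>) \<omega>" by simp
    moreover have "1 - t = s" using t by simp
    ultimately show "F (s *\<^sub>R y \<omega> + t *\<^sub>R z \<omega>) \<omega> \<le> s * F (y \<omega>) \<omega> + t * F (z \<omega>) \<omega>"
      by (simp only:)
  qed (use int[OF y] int[OF z] int[OF decisions_convex[OF y z t]] in auto)
  also have "\<dots> = s * expected F y + t * expected F z"
    using int[OF y] int[OF z] by (simp add: expected_def)
  finally show ?thesis .
qed

lemma expected_lower_bound: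
  assumes F: "convex_integrand F"
  shows "\<exists>b. \<forall>y\<in>decisions. - b \<le> expected F y"
proof -
  obtain b where b: "\<And>\<omega> y. \<omega> \<in> space M \<Longrightarrow> y \<in> C1 \<times> C2 \<Longrightarrow> - b \<le> F y \<omega>"
    using F unfolding convex_integrand_def by blast
  have "- b \<le> expected F y" if y: "y \<in> decisions" for y
  proof -
    have "(\<integral>\<omega>. - b \<partial>M) \<le> expected F y" unfolding expected_def
    proof (rule integral_mono_AE)
      show "AE \<omega> in M. - b \<le> F (y \<omega>) \<omega>"
        using decisions_AE[OF y] AE_space by eventually_elim (rule b)
    qed (use F y in \<open>auto simp: convex_integrand_def\<close>)
    then show ?thesis by (simp add: prob_space)
  qed
  then show ?thesis by blast
qed

text \<open>Fatou's lemma after a shift by the lower bound. The estimate is required only from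
  \<open>N\<close> on, because in \<open>decisions_compact\<close> the n-th condition holds only
  along a tail of the selected sequence.\<close>

lemma expected_weakly_lsc:
  assumes F: "convex_integrand F" and g: "\<And>n. g n \<in> decisions" and y: "y \<in> decisions"
    and wl: "AE \<omega> in M. weakly_tendsto (\<lambda>n. g n \<omega>) (y \<omega>)"
    and le: "\<And>n. N \<le> n \<Longrightarrow> expected F (g n) \<le> c"
  shows "expected F y \<le> c"
proof -
  obtain b where b: "\<And>\<omega> y. \<omega> \<in> space M \<Longrightarrow> y \<in> C1 \<times> C2 \<Longrightarrow> - b \<le> F y \<omega>"
    using F unfolding convex_integrand_def by blast
  have int: "integrable M (\<lambda>\<omega>. F (z \<omega>) \<omega>)" if "z \<in> decisions" for z
    using F that by (auto simp: convex_integrand_def)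
  have nonneg: "AE \<omega> in M. 0 \<le> F (z \<omega>) \<omega> + b" if z: "z \<in> decisions" for z
    using decisions_AE[OF z] AE_space
  proof eventually_elim
    case (elim \<omega>) then show ?case using b[of \<omega> "z \<omega>"] by linarith
  qed
  have eq: "(\<integral>\<^sup>+\<omega>. ennreal (F (z \<omega>) \<omega> + b) \<partial>M) = ennreal (expected F z + b)" if z: "z \<in> decisions" for z
  proof -
    have "(\<integral>\<^sup>+\<omega>. ennreal (F (z \<omega>) \<omega> + b) \<partial>M) = ennreal (\<integral>\<omega>. F (z \<omega>) \<omega> + b \<partial>M)"
      using int[OF z] nonneg[OF z] by (intro nn_integral_eq_integral) auto
    also have "(\<integral>\<omega>. F (z \<omega>) \<omega> + b \<partial>M) = expected F z + b"
      using int[OF z] by (simp add: expected_def prob_space)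
    finally show ?thesis .
  qed
  have pos: "0 \<le> expected F z + b" if z: "z \<in> decisions" for z
  proof -
    have "0 \<le> (\<integral>\<omega>. F (z \<omega>) \<omega> + b \<partial>M)" using nonneg[OF z] by (rule integral_nonneg_AE)
    also have "\<dots> = expected F z + b" using int[OF z] by (simp add: expected_def prob_space)
    finally show ?thesis .
  qed
  have "ennreal (expected F y + b) = (\<integral>\<^sup>+\<omega>. ennreal (F (y \<omega>) \<omega> + b) \<partial>M)" by (rule eq[OF y, symmetric])
  also have "\<dots> \<le> (\<integral>\<^sup>+\<omega>. liminf (\<lambda>n. ennreal (F (g n \<omega>) \<omega> + b)) \<partial>M)"
  proof (rule nn_integral_mono_AE)
    show "AE \<omega> in M. ennreal (F (y \<omega>) \<omega> + b) \<le> liminf (\<lambda>n. ennreal (F (g n \<omega>) \<omega> + b))"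
      using wl AE_space
    proof eventually_elim
      case (elim \<omega>)
      then show ?case
        using F by (intro weakly_tendsto_convex_liminf[where p="\<lambda>y. F y \<omega>"]) (auto simp: convex_integrand_def)
    qed
  qed
  also have "\<dots> \<le> liminf (\<lambda>n. \<integral>\<^sup>+\<omega>. ennreal (F (g n \<omega>) \<omega> + b) \<partial>M)"
    using int[OF g] by (intro nn_integral_liminf) (auto intro!: borel_measurable_integrable)
  also have "\<dots> = liminf (\<lambda>n. ennreal (expected F (g n) + b))" by (simp add: eq[OF g])
  also have "\<dots> \<le> liminf (\<lambda>n. ennreal (c + b))"
    using le by (intro Liminf_mono eventually_sequentiallyI[of N] ennreal_leI) auto
  also have "\<dots> = ennreal (c + b)" by (simp add: Liminf_const)
  finally have "expected F y + b \<le> c + b"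
    using pos[OF g[of N]] le[of N] by (subst (asm) ennreal_le_iff) auto
  then show ?thesis by simp
qed

text \<open>The first components do not depend on \<omega>, but on a null set the first component of
  \<open>l\<close> may be anything. Its value at one point \<open>\<omega>0\<close> of convergence
  is therefore used everywhere.\<close>

lemma decisions_weak_limit:
  assumes g: "\<And>n. g n \<in> decisions" and l: "l \<in> borel_measurable M"
    and wl: "AE \<omega> in M. weakly_tendsto (\<lambda>n. g n \<omega>) (l \<omega>)"
  shows "\<exists>y\<in>decisions. AE \<omega> in M. weakly_tendsto (\<lambda>n. g n \<omega>) (y \<omega>)"
proof -
  have "\<forall>n. \<exists>a. \<forall>\<omega>. fst (g n \<omega>) = a" using g by (auto simp: decisions_def)
  then obtain a where a: "\<And>n \<omega>. fst (g n \<omega>) = a n" by metis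
  obtain \<omega>0 where \<omega>0: "weakly_tendsto (\<lambda>n. g n \<omega>0) (l \<omega>0)"
    using eventually_happens'[OF _ wl] by (auto simp: ae_filter_eq_bot_iff emeasure_space_1)
  define y where "y \<omega> = (fst (l \<omega>0), snd (l \<omega>))" for \<omega>
  have wy: "AE \<omega> in M. weakly_tendsto (\<lambda>n. g n \<omega>) (y \<omega>)"
    using wl
  proof eventually_elim
    case (elim \<omega>)
    show ?case unfolding weakly_tendsto_def
    proof
      fix f :: "('x1 \<times> 'x2) \<Rightarrow>\<^sub>L real"
      obtain f1 f2 where f: "\<And>x y. f (x, y) = blinfun_apply f1 x + blinfun_apply f2 y"
        using blinfun_Pair_split[of f] by blast
      have f': "f p = f1 (fst p) + f2 (snd p)" for p using f[of "fst p" "snd p"] by simp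
      have "(\<lambda>n. (f1 o\<^sub>L fst_blinfun) (g n \<omega>0) + (f2 o\<^sub>L snd_blinfun) (g n \<omega>))
          \<longlonglongrightarrow> (f1 o\<^sub>L fst_blinfun) (l \<omega>0) + (f2 o\<^sub>L snd_blinfun) (l \<omega>)"
        using \<omega>0 elim unfolding weakly_tendsto_def by (intro tendsto_add) blast+
      then show "(\<lambda>n. f (g n \<omega>)) \<longlonglongrightarrow> f (y \<omega>)"
        by (simp add: f' a y_def)
    qed
  qed
  have "AE \<omega> in M. \<forall>n. g n \<omega> \<in> C1 \<times> C2" using decisions_AE[OF g] by (simp add: AE_all_countable)
  with wy have "AE \<omega> in M. y \<omega> \<in> C1 \<times> C2"
  proof eventually_elim
    case (elim \<omega>)
    show ?case
      by (rule weakly_tendsto_in_closed_convex[OF elim(1)])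
         (use elim(2) convex_Times[OF C1(2) C2(2)] closed_Times[OF C1(3) C2(3)] in auto)
  qed
  moreover have "y \<in> borel_measurable M"
    unfolding y_def
    by (intro borel_measurable_Pair borel_measurable_const borel_measurable_continuous_on[OF _ l] continuous_intros)
  ultimately have "y \<in> decisions" by (auto simp: decisions_def y_def)
  then show ?thesis using wy by blast
qed

text \<open>A finite intersection property for sublevel sets of countably many convex functionals;
  it is the only form in which weak compactness is used below.\<close>

lemma decisions_compact:
  assumes F: "\<And>n. convex_integrand (F n)"
    and ex: "\<And>m. \<exists>y\<in>decisions. \<forall>n\<le>m. expected (F n) y \<le> a n"
  shows "\<exists>y\<in>decisions. \<forall>n::nat. expected (F n) y \<le> a n"
proof -
  define B where "B m = {y\<in>decisions. \<forall>n\<le>m. expected (F n) y \<le> a n}" for m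
  obtain R where R: "\<And>y. y \<in> decisions \<Longrightarrow> AE \<omega> in M. norm (y \<omega>) \<le> R"
    using decisions_bounded by blast
  have "\<exists>g l. (\<forall>m. g m \<in> B m) \<and> l \<in> borel_measurable M \<and>
      (AE \<omega> in M. weakly_tendsto (\<lambda>m. g m \<omega>) (l \<omega>))"
  proof (rule weak_pointwise_selection[OF complete refl, where R=R])
    show "B m \<noteq> {}" for m using ex[of m] by (auto simp: B_def)
    show "decseq B" by (auto simp: decseq_def B_def)
    show "(\<lambda>\<omega>. (1/2) *\<^sub>R f \<omega> + (1/2) *\<^sub>R g \<omega>) \<in> B m" if "f \<in> B m" "g \<in> B m" for f g m
    proof -
      have fg: "f \<in> decisions" "g \<in> decisions" using that by (auto simp: B_def)
      have "expected (F n) (\<lambda>\<omega>. (1/2) *\<^sub>R f \<omega> + (1/2) *\<^sub>R g \<omega>) \<le> a n" if "n \<le> m" for n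
      proof -
        have "expected (F n) f \<le> a n" "expected (F n) g \<le> a n"
          using \<open>f \<in> B m\<close> \<open>g \<in> B m\<close> that by (auto simp: B_def)
        then show ?thesis using expected_convex[OF F[of n] fg, of "1/2" "1/2"] by simp
      qed
      then show ?thesis using decisions_convex[OF fg, of "1/2" "1/2"] by (simp add: B_def)
    qed
  qed (auto simp: B_def intro: decisions_measurable R)
  then obtain g l where g: "\<And>m. g m \<in> B m" and l: "l \<in> borel_measurable M"
    and wl: "AE \<omega> in M. weakly_tendsto (\<lambda>m. g m \<omega>) (l \<omega>)" by blast
  have gD: "g m \<in> decisions" for m using g[of m] by (simp add: B_def)
  obtain y where y: "y \<in> decisions" and wy: "AE \<omega> in M. weakly_tendsto (\<lambda>n. g n \<omega>) (y \<omega>)"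
    using decisions_weak_limit[OF gD l wl] by blast
  have "expected (F n) y \<le> a n" for n
    by (rule expected_weakly_lsc[OF F gD y wy, of n]) (use g in \<open>auto simp: B_def\<close>)
  then show ?thesis using y by blast
qed

text \<open>The compactness lemma with one fixed integrand and levels that decrease to the
  infimum.\<close>

lemma expected_attains_min:
  assumes F: "convex_integrand F"
  shows "\<exists>y\<in>decisions. \<forall>z\<in>decisions. expected F y \<le> expected F z"
proof -
  obtain b where b: "\<And>y. y \<in> decisions \<Longrightarrow> - b \<le> expected F y" using expected_lower_bound[OF F] by blast
  define I where "I = Inf (expected F ` decisions)"
  have I: "I \<le> expected F z" if "z \<in> decisions" for z
    unfolding I_def using that b by (intro cInf_lower bdd_belowI[of _ "- b"]) auto
  have "\<exists>y\<in>decisions. \<forall>n::nat. expected F y \<le> I + 1 / Suc n"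
  proof (rule decisions_compact[OF F])
    fix m :: nat
    obtain y where y: "y \<in> decisions" "expected F y < I + 1 / Suc m"
      using cInf_lessD[of "expected F ` decisions" "I + 1 / Suc m"] decisions_nonempty by (auto simp: I_def)
    have "expected F y \<le> I + 1 / Suc n" if "n \<le> m" for n
    proof -
      have "1 / real (Suc m) \<le> 1 / real (Suc n)" using that by (intro divide_left_mono) auto
      then show ?thesis using y(2) by linarith
    qed
    then show "\<exists>y\<in>decisions. \<forall>n\<le>m. expected F y \<le> I + 1 / Suc n" using y(1) by blast
  qed
  then obtain y where y: "y \<in> decisions" and le: "\<And>n::nat. expected F y \<le> I + 1 / Suc n" by blast
  have "(\<lambda>n. I + 1 / Suc n) \<longlonglongrightarrow> I + 0"
    by (intro tendsto_add tendsto_const LIMSEQ_Suc[OF lim_1_over_n])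
  then have "expected F y \<le> I" using le by (intro LIMSEQ_le_const) auto
  then show ?thesis using y I by (meson order_trans)
qed

end

subsection \<open>Quadratic penalization\<close>

lemma convex_on_pos_part_square:
  fixes f :: "'a::real_vector \<Rightarrow> real"
  assumes f: "convex_on UNIV f"
  shows "convex_on UNIV (\<lambda>x. (max 0 (f x))\<^sup>2)"
proof (rule convex_onI)
  fix t :: real and x y assume t: "0 < t" "t < 1"
  define p q where "p = max 0 (f x)" and "q = max 0 (f y)"
  have "f ((1 - t) *\<^sub>R x + t *\<^sub>R y) \<le> (1 - t) * f x + t * f y"
    using t by (intro convex_onD[OF f]) auto
  also have "\<dots> \<le> (1 - t) * p + t * q" using t by (intro add_mono mult_left_mono) (auto simp: p_def q_def)
  finally have "max 0 (f ((1 - t) *\<^sub>R x + t *\<^sub>R y)) \<le> (1 - t) * p + t * q"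
    using t by (auto simp: p_def q_def intro!: add_nonneg_nonneg mult_nonneg_nonneg)
  then have "(max 0 (f ((1 - t) *\<^sub>R x + t *\<^sub>R y)))\<^sup>2 \<le> ((1 - t) * p + t * q)\<^sup>2"
    by (intro power_mono) auto
  also have "\<dots> = (1 - t) * p\<^sup>2 + t * q\<^sup>2 - t * (1 - t) * (p - q)\<^sup>2"
    by (simp add: power2_eq_square algebra_simps)
  also have "\<dots> \<le> (1 - t) * p\<^sup>2 + t * q\<^sup>2" using t by simp
  finally show "(max 0 (f ((1 - t) *\<^sub>R x + t *\<^sub>R y)))\<^sup>2 \<le> (1 - t) * (max 0 (f x))\<^sup>2 + t * (max 0 (f y))\<^sup>2"
    by (simp add: p_def q_def)
qed simp

text \<open>A global second-order bound for (max 0 s)^2, whose derivative at \<open>a\<close> is 2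
  max 0 a. It spares differentiation under the integral sign.\<close>

lemma pos_part_square_expansion:
  fixes a d t :: real
  assumes "0 \<le> t"
  shows "(max 0 (a + t * d))\<^sup>2 \<le> (max 0 a)\<^sup>2 + 2 * t * (max 0 a * d) + t\<^sup>2 * d\<^sup>2"
proof (cases "0 \<le> a")
  case True
  have "(max 0 (a + t * d))\<^sup>2 \<le> \<bar>a + t * d\<bar>\<^sup>2" by (intro power_mono) auto
  then show ?thesis using True by (simp add: power2_eq_square algebra_simps)
next
  case False
  then have "(max 0 (a + t * d))\<^sup>2 \<le> \<bar>t * d\<bar>\<^sup>2" by (intro power_mono) auto
  then show ?thesis using False by (simp add: power_mult_distrib)
qed

lemma (in prob_space) integrable_mult_AE_bounded:
  fixes f g :: "'a \<Rightarrow> real"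
  assumes "f \<in> borel_measurable M" "AE \<omega> in M. \<bar>f \<omega>\<bar> \<le> A"
    and "g \<in> borel_measurable M" "AE \<omega> in M. \<bar>g \<omega>\<bar> \<le> B"
  shows "integrable M (\<lambda>\<omega>. f \<omega> * g \<omega>)"
proof (rule integrable_const_bound[where B="\<bar>A\<bar> * \<bar>B\<bar>"])
  show "AE \<omega> in M. norm (f \<omega> * g \<omega>) \<le> \<bar>A\<bar> * \<bar>B\<bar>"
    using assms(2,4) by eventually_elim (auto simp: abs_mult intro!: mult_mono)
qed (use assms in measurable)

context two_stage
begin

text \<open>Essential boundedness along decisions makes the squared violations and their products
  with multipliers integrable.\<close>

definition convex_constraints :: "(nat \<Rightarrow> 'x1 \<times> 'x2 \<Rightarrow> 'o \<Rightarrow> real) \<Rightarrow> bool" where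
  "convex_constraints c \<longleftrightarrow>
     (\<forall>k. \<forall>\<omega>\<in>space M. convex_on UNIV (\<lambda>y. c k y \<omega>) \<and> continuous_on UNIV (\<lambda>y. c k y \<omega>)) \<and>
     (\<forall>k. \<forall>y\<in>decisions. (\<lambda>\<omega>. c k (y \<omega>) \<omega>) \<in> borel_measurable M \<and> (\<exists>B. AE \<omega> in M. \<bar>c k (y \<omega>) \<omega>\<bar> \<le> B))"

text \<open>One parameter is both the number of penalized constraints and their weight. Thus the
  functionals increase with \<open>n\<close>, and each fixed constraint eventually receives
  arbitrarily large weight.\<close>

definition penalized ::
  "('x1 \<times> 'x2 \<Rightarrow> 'o \<Rightarrow> real) \<Rightarrow> (nat \<Rightarrow> 'x1 \<times> 'x2 \<Rightarrow> 'o \<Rightarrow> real) \<Rightarrow> nat \<Rightarrow> 'x1 \<times> 'x2 \<Rightarrow> 'o \<Rightarrow> real" where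
  "penalized J c n y \<omega> = J y \<omega> + n * (\<Sum>k<n. (max 0 (c k y \<omega>))\<^sup>2)"

lemma constraint_measurable:
  "convex_constraints c \<Longrightarrow> y \<in> decisions \<Longrightarrow> (\<lambda>\<omega>. c k (y \<omega>) \<omega>) \<in> borel_measurable M"
  by (auto simp: convex_constraints_def)

lemma constraint_bounded:
  "convex_constraints c \<Longrightarrow> y \<in> decisions \<Longrightarrow> \<exists>B. AE \<omega> in M. \<bar>c k (y \<omega>) \<omega>\<bar> \<le> B"
  by (auto simp: convex_constraints_def)

lemma constraint_pos_bounded:
  assumes "convex_constraints c" "y \<in> decisions"
  shows "\<exists>B. AE \<omega> in M. \<bar>max 0 (c k (y \<omega>) \<omega>)\<bar> \<le> B"
proof -
  obtain B where "AE \<omega> in M. \<bar>c k (y \<omega>) \<omega>\<bar> \<le> B" using constraint_bounded[OF assms] by blast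
  then have "AE \<omega> in M. \<bar>max 0 (c k (y \<omega>) \<omega>)\<bar> \<le> B" by eventually_elim auto
  then show ?thesis by blast
qed

lemma integrable_constraint_square:
  assumes c: "convex_constraints c" and y: "y \<in> decisions"
  shows "integrable M (\<lambda>\<omega>. (max 0 (c k (y \<omega>) \<omega>))\<^sup>2)"
proof -
  obtain B where B: "AE \<omega> in M. \<bar>max 0 (c k (y \<omega>) \<omega>)\<bar> \<le> B" using constraint_pos_bounded[OF assms] by blast
  note [measurable] = constraint_measurable[OF c y]
  show ?thesis unfolding power2_eq_square
    by (rule integrable_mult_AE_bounded[OF _ B _ B]) measurable
qed

lemma convex_integrand_penalized:
  assumes J: "convex_integrand J" and c: "convex_constraints c"
  shows "convex_integrand (penalized J c n)"
  unfolding convex_integrand_def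
proof (intro conjI ballI)
  fix \<omega> assume \<omega>: "\<omega> \<in> space M"
  have Jw: "convex_on UNIV (\<lambda>y. J y \<omega>)" "continuous_on UNIV (\<lambda>y. J y \<omega>)"
    using J \<omega> by (auto simp: convex_integrand_def)
  have cw: "convex_on UNIV (\<lambda>y. c k y \<omega>)" "continuous_on UNIV (\<lambda>y. c k y \<omega>)" for k
    using c \<omega> by (auto simp: convex_constraints_def)
  have "convex_on UNIV (\<lambda>y. \<Sum>k\<in>{..<m}. (max 0 (c k y \<omega>))\<^sup>2)" for m :: nat
    by (induction m) (auto intro!: convex_on_add convex_on_pos_part_square cw simp: convex_on_const)
  then show "convex_on UNIV (\<lambda>y. penalized J c n y \<omega>)"
    unfolding penalized_def by (intro convex_on_add convex_on_cmul Jw) auto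
  show "continuous_on UNIV (\<lambda>y. penalized J c n y \<omega>)"
    unfolding penalized_def by (intro continuous_intros Jw cw)
next
  obtain b where "\<And>\<omega> y. \<omega> \<in> space M \<Longrightarrow> y \<in> C1 \<times> C2 \<Longrightarrow> - b \<le> J y \<omega>"
    using J unfolding convex_integrand_def by blast
  moreover have "J y \<omega> \<le> penalized J c n y \<omega>" for y \<omega>
    unfolding penalized_def by (simp add: sum_nonneg)
  ultimately show "\<exists>b. \<forall>\<omega>\<in>space M. \<forall>y\<in>C1 \<times> C2. - b \<le> penalized J c n y \<omega>" by (meson order_trans)
next
  fix y assume y: "y \<in> decisions"
  then have "integrable M (\<lambda>\<omega>. J (y \<omega>) \<omega>)" using J by (auto simp: convex_integrand_def)
  then show "integrable M (\<lambda>\<omega>. penalized J c n (y \<omega>) \<omega>)"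
    unfolding penalized_def
    by (intro Bochner_Integration.integrable_add integrable_mult_right Bochner_Integration.integrable_sum integrable_constraint_square[OF c y])
qed

lemma expected_penalized:
  assumes J: "convex_integrand J" and c: "convex_constraints c" and y: "y \<in> decisions"
  shows "expected (penalized J c n) y = expected J y + n * (\<Sum>k<n. \<integral>\<omega>. (max 0 (c k (y \<omega>) \<omega>))\<^sup>2 \<partial>M)"
proof -
  have "integrable M (\<lambda>\<omega>. J (y \<omega>) \<omega>)" using J y by (auto simp: convex_integrand_def)
  then show ?thesis unfolding expected_def penalized_def
    using integrable_constraint_square[OF c y]
    by (simp add: Bochner_Integration.integral_sum)
qed

text \<open>Monotonicity in \<open>n\<close> turns a bound for one \<open>m\<close> into bounds for
  all smaller indices, so compactness gives one decision satisfying all bounds. Its violation of a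
  fixed constraint, multiplied by arbitrarily large weights, stays bounded and hence
  vanishes.\<close>

lemma penalized_limit:
  assumes J: "convex_integrand J" and c: "convex_constraints c"
    and ex: "\<And>n. \<exists>y\<in>decisions. expected (penalized J c n) y \<le> \<alpha>"
  shows "\<exists>y\<in>decisions. expected J y \<le> \<alpha> \<and> (AE \<omega> in M. \<forall>k. c k (y \<omega>) \<omega> \<le> 0)"
proof -
  have I0: "0 \<le> (\<integral>\<omega>. (max 0 (c k (y \<omega>) \<omega>))\<^sup>2 \<partial>M)" for k y by (intro integral_nonneg_AE) auto
  have mono: "expected (penalized J c n) y \<le> expected (penalized J c m) y" if "n \<le> m" "y \<in> decisions" for n m y
  proof -
    have "n * (\<Sum>k<n. \<integral>\<omega>. (max 0 (c k (y \<omega>) \<omega>))\<^sup>2 \<partial>M) \<le> m * (\<Sum>k<m. \<integral>\<omega>. (max 0 (c k (y \<omega>) \<omega>))\<^sup>2 \<partial>M)"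
      using that I0 by (intro mult_mono sum_mono2 sum_nonneg) auto
    then show ?thesis using that by (simp add: expected_penalized[OF J c])
  qed
  have "\<exists>y\<in>decisions. \<forall>n. expected (penalized J c n) y \<le> \<alpha>"
  proof (rule decisions_compact)
    fix m
    obtain y where y: "y \<in> decisions" "expected (penalized J c m) y \<le> \<alpha>" using ex by blast
    then show "\<exists>y\<in>decisions. \<forall>n\<le>m. expected (penalized J c n) y \<le> \<alpha>"
      using mono by (intro bexI[of _ y]) (auto intro: order_trans)
  qed (rule convex_integrand_penalized[OF J c])
  then obtain y where y: "y \<in> decisions" and le: "\<And>n. expected (penalized J c n) y \<le> \<alpha>" by blast
  \<comment> \<open>For n = 0 the penalty is an empty sum.\<close>
  have "expected J y \<le> \<alpha>" using le[of 0] by (simp add: expected_penalized[OF J c y])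
  moreover have "AE \<omega> in M. c k (y \<omega>) \<omega> \<le> 0" for k
  proof -
    define I where "I = (\<integral>\<omega>. (max 0 (c k (y \<omega>) \<omega>))\<^sup>2 \<partial>M)"
    have bnd0: "real n * I \<le> \<alpha> - expected J y" if "k < n" for n
    proof -
      have "I \<le> (\<Sum>j<n. \<integral>\<omega>. (max 0 (c j (y \<omega>) \<omega>))\<^sup>2 \<partial>M)"
        unfolding I_def using that I0 by (intro member_le_sum) auto
      then have "real n * I \<le> n * (\<Sum>j<n. \<integral>\<omega>. (max 0 (c j (y \<omega>) \<omega>))\<^sup>2 \<partial>M)" by (intro mult_left_mono) auto
      then show ?thesis using le[of n] by (simp add: expected_penalized[OF J c y])
    qed
    \<comment> \<open>Constraint \<open>k\<close> belongs to the first \<open>n\<close> only when n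
      \<ge> k + 1.\<close>
    have bnd: "real (Suc (k + n)) * I \<le> \<alpha> - expected J y" for n by (rule bnd0) simp
    have "I = 0"
    proof (rule ccontr)
      assume "I \<noteq> 0"
      moreover have "0 \<le> I" unfolding I_def by (rule I0)
      ultimately have pos: "0 < I" by simp
      obtain n :: nat where n: "(\<alpha> - expected J y) / I < n" using reals_Archimedean2 by blast
      have "\<alpha> - expected J y < n * I" using n pos by (simp add: field_simps)
      also have "\<dots> \<le> real (Suc (k + n)) * I" using pos by (intro mult_right_mono) auto
      finally show False using bnd[of n] by simp
    qed
    then have "AE \<omega> in M. (max 0 (c k (y \<omega>) \<omega>))\<^sup>2 = 0"
      using integral_nonneg_eq_0_iff_AE[OF integrable_constraint_square[OF c y, of k]] by (auto simp: I_def)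
    then show ?thesis by eventually_elim (simp add: max_def split: if_splits)
  qed
  ultimately show ?thesis using y by (auto simp: AE_all_countable)
qed

text \<open>First-order optimality: the derivatives of the quadratic penalties act as multipliers.\<close>

lemma penalized_multipliers:
  assumes J: "convex_integrand J" and c: "convex_constraints c"
    and y: "y \<in> decisions" and min: "\<And>z. z \<in> decisions \<Longrightarrow> expected (penalized J c n) y \<le> expected (penalized J c n) z"
    and z: "z \<in> decisions"
  shows "expected (penalized J c n) y
    \<le> expected J z + (\<Sum>k<n. \<integral>\<omega>. 2 * n * max 0 (c k (y \<omega>) \<omega>) * c k (z \<omega>) \<omega> \<partial>M)"
proof -
  define a where "a k \<omega> = c k (y \<omega>) \<omega>" for k \<omega>
  define d where "d k \<omega> = c k (z \<omega>) \<omega> - c k (y \<omega>) \<omega>" for k \<omega>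
  have am[measurable]: "a k \<in> borel_measurable M" for k
    using constraint_measurable[OF c y] by (simp add: a_def[abs_def])
  have zm[measurable]: "(\<lambda>\<omega>. c k (z \<omega>) \<omega>) \<in> borel_measurable M" for k
    using constraint_measurable[OF c z] by simp
  have dm[measurable]: "d k \<in> borel_measurable M" for k
    using am zm by (simp add: d_def[abs_def] a_def[abs_def])
  obtain B where aB: "\<And>k. AE \<omega> in M. \<bar>max 0 (a k \<omega>)\<bar> \<le> B k"
    using constraint_pos_bounded[OF c y] unfolding a_def by metis
  obtain A where A: "\<And>k. AE \<omega> in M. \<bar>c k (y \<omega>) \<omega>\<bar> \<le> A k"
    using constraint_bounded[OF c y] by metis
  obtain Z where Z: "\<And>k. AE \<omega> in M. \<bar>c k (z \<omega>) \<omega>\<bar> \<le> Z k"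
    using constraint_bounded[OF c z] by metis
  have dB: "AE \<omega> in M. \<bar>d k \<omega>\<bar> \<le> Z k + A k" for k
    using Z[of k] A[of k] by eventually_elim (auto simp: d_def)
  have i1: "integrable M (\<lambda>\<omega>. max 0 (a k \<omega>) * d k \<omega>)" for k
    by (rule integrable_mult_AE_bounded[OF _ aB _ dB]) measurable
  have i2: "integrable M (\<lambda>\<omega>. (d k \<omega>)\<^sup>2)" for k
    unfolding power2_eq_square by (rule integrable_mult_AE_bounded[OF _ dB _ dB]) measurable
  have i3: "integrable M (\<lambda>\<omega>. (max 0 (a k \<omega>))\<^sup>2)" for k
    using integrable_constraint_square[OF c y] by (simp add: a_def)
  have i4: "integrable M (\<lambda>\<omega>. max 0 (a k \<omega>) * c k (z \<omega>) \<omega>)" for k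
    by (rule integrable_mult_AE_bounded[OF _ aB _ Z]) measurable
  define P where "P k = (\<integral>\<omega>. (max 0 (a k \<omega>))\<^sup>2 \<partial>M)" for k
  define L where "L k = (\<integral>\<omega>. max 0 (a k \<omega>) * d k \<omega> \<partial>M)" for k
  define Q where "Q k = (\<integral>\<omega>. (d k \<omega>)\<^sup>2 \<partial>M)" for k
  have P0: "0 \<le> P k" for k unfolding P_def by (intro integral_nonneg_AE) auto
  \<comment> \<open>\<open>D\<close> is the first-order coefficient on the segment from
    \<open>y\<close> to \<open>z\<close>, \<open>E\<close> that of the quadratic remainder.
    Minimality gives 0 \<le> D + t * E, and t tends to 0.\<close>
  define D where "D = expected J z - expected J y + 2 * n * (\<Sum>k<n. L k)"
  define E where "E = n * (\<Sum>k<n. Q k)"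
  have slope: "0 \<le> D + t * E" if t: "0 < t" "t < 1" for t :: real
  proof -
    define w where "w \<omega> = (1 - t) *\<^sub>R y \<omega> + t *\<^sub>R z \<omega>" for \<omega>
    have wD: "w \<in> decisions" unfolding w_def using t by (intro decisions_convex y z) auto
    have Jw: "expected J w \<le> (1 - t) * expected J y + t * expected J z"
      unfolding w_def using t by (intro expected_convex J y z) auto
    have cw: "(\<integral>\<omega>. (max 0 (c k (w \<omega>) \<omega>))\<^sup>2 \<partial>M) \<le> P k + 2 * t * L k + t\<^sup>2 * Q k" for k
    proof -
      have "(\<integral>\<omega>. (max 0 (c k (w \<omega>) \<omega>))\<^sup>2 \<partial>M)
          \<le> (\<integral>\<omega>. (max 0 (a k \<omega>))\<^sup>2 + 2 * t * (max 0 (a k \<omega>) * d k \<omega>) + t\<^sup>2 * (d k \<omega>)\<^sup>2 \<partial>M)"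
      proof (rule integral_mono)
        fix \<omega> assume "\<omega> \<in> space M"
        then have "convex_on UNIV (\<lambda>y. c k y \<omega>)" using c by (auto simp: convex_constraints_def)
        from convex_onD[OF this, of t "y \<omega>" "z \<omega>"] t
        have "c k (w \<omega>) \<omega> \<le> (1 - t) * c k (y \<omega>) \<omega> + t * c k (z \<omega>) \<omega>" by (simp add: w_def)
        also have "\<dots> = a k \<omega> + t * d k \<omega>" by (simp add: a_def d_def algebra_simps)
        finally have "(max 0 (c k (w \<omega>) \<omega>))\<^sup>2 \<le> (max 0 (a k \<omega> + t * d k \<omega>))\<^sup>2"
          by (intro power_mono) auto
        also have "\<dots> \<le> (max 0 (a k \<omega>))\<^sup>2 + 2 * t * (max 0 (a k \<omega>) * d k \<omega>) + t\<^sup>2 * (d k \<omega>)\<^sup>2"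
          using t by (intro pos_part_square_expansion) auto
        finally show "(max 0 (c k (w \<omega>) \<omega>))\<^sup>2 \<le> (max 0 (a k \<omega>))\<^sup>2 + 2 * t * (max 0 (a k \<omega>) * d k \<omega>) + t\<^sup>2 * (d k \<omega>)\<^sup>2" .
      qed (use integrable_constraint_square[OF c wD] i1 i2 i3 in auto)
      also have "\<dots> = P k + 2 * t * L k + t\<^sup>2 * Q k" using i1 i2 i3 by (simp add: P_def L_def Q_def)
      finally show ?thesis .
    qed
    have "expected J y + n * (\<Sum>k<n. P k) = expected (penalized J c n) y"
      by (simp add: expected_penalized[OF J c y] P_def a_def)
    also have "\<dots> \<le> expected (penalized J c n) w" by (rule min[OF wD])
    also have "\<dots> = expected J w + n * (\<Sum>k<n. \<integral>\<omega>. (max 0 (c k (w \<omega>) \<omega>))\<^sup>2 \<partial>M)"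
      by (rule expected_penalized[OF J c wD])
    also have "\<dots> \<le> ((1 - t) * expected J y + t * expected J z) + n * (\<Sum>k<n. P k + 2 * t * L k + t\<^sup>2 * Q k)"
      by (intro add_mono Jw mult_left_mono sum_mono cw) auto
    also have "(\<Sum>k<n. P k + 2 * t * L k + t\<^sup>2 * Q k)
        = (\<Sum>k<n. P k) + 2 * t * (\<Sum>k<n. L k) + t\<^sup>2 * (\<Sum>k<n. Q k)"
      by (simp add: sum.distrib sum_distrib_left)
    also have "(1 - t) * expected J y + t * expected J z + n * \<dots>
        = expected J y + n * (\<Sum>k<n. P k) + t * (D + t * E)"
      by (simp add: D_def E_def power2_eq_square algebra_simps)
    finally have "0 \<le> t * (D + t * E)" by simp
    then show ?thesis using t by (simp add: zero_le_mult_iff)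
  qed
  have "0 \<le> D"
  proof -
    have "((\<lambda>t. D + t * E) \<longlongrightarrow> D + 0 * E) (at_right 0)"
      by (intro tendsto_intros)
    moreover have "\<forall>\<^sub>F t in at_right 0. 0 \<le> D + t * E"
      unfolding eventually_at_right_field by (intro exI[of _ 1]) (use slope in auto)
    ultimately have "0 \<le> D + 0 * E" by (intro tendsto_lowerbound[of _ _ "at_right 0"]) auto
    then show ?thesis by simp
  qed
  moreover have "L k = (\<integral>\<omega>. max 0 (a k \<omega>) * c k (z \<omega>) \<omega> \<partial>M) - P k" for k
  proof -
    have "L k = (\<integral>\<omega>. max 0 (a k \<omega>) * c k (z \<omega>) \<omega> - (max 0 (a k \<omega>))\<^sup>2 \<partial>M)" unfolding L_def
      by (intro Bochner_Integration.integral_cong) (auto simp: a_def d_def max_def power2_eq_square algebra_simps)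
    then show ?thesis using i3 i4 by (simp add: P_def)
  qed
  ultimately have "0 \<le> expected J z - expected J y
      + 2 * n * ((\<Sum>k<n. \<integral>\<omega>. max 0 (a k \<omega>) * c k (z \<omega>) \<omega> \<partial>M) - (\<Sum>k<n. P k))"
    by (simp add: D_def sum_subtractf)
  \<comment> \<open>Optimality supplies the squares with factor 2 n, the penalized value contains
    them with factor n; the surplus has the right sign.\<close>
  moreover have "n * (\<Sum>k<n. P k) \<le> 2 * n * (\<Sum>k<n. P k)"
    using P0 by (intro mult_right_mono sum_nonneg) auto
  moreover have "expected (penalized J c n) y = expected J y + n * (\<Sum>k<n. P k)"
    by (simp add: expected_penalized[OF J c y] P_def a_def)
  moreover have "(\<Sum>k<n. \<integral>\<omega>. 2 * n * max 0 (c k (y \<omega>) \<omega>) * c k (z \<omega>) \<omega> \<partial>M)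
      = 2 * n * (\<Sum>k<n. \<integral>\<omega>. max 0 (a k \<omega>) * c k (z \<omega>) \<omega> \<partial>M)"
    by (simp add: a_def sum_distrib_left mult.assoc)
  ultimately show ?thesis by (simp add: right_diff_distrib)
qed

end

subsection \<open>Strong duality\<close>

text \<open>The exceptional null set of the hypothesis depends on \<open>y\<close>. A countable
  dense set merges these sets into one, and continuity extends the bound; the ball is open so that
  dense points near \<open>y\<close> stay inside.\<close>

lemma AE_ball_bounded:
  fixes F :: "'a::{real_normed_vector, second_countable_topology} \<Rightarrow> 'o \<Rightarrow> 'b::real_normed_vector"
  assumes cont: "\<And>\<omega>. \<omega> \<in> space M \<Longrightarrow> continuous_on UNIV (\<lambda>y. F y \<omega>)"
    and bd: "\<And>y. norm y < r \<Longrightarrow> AE \<omega> in M. norm (F y \<omega>) \<le> b"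
  shows "AE \<omega> in M. \<forall>y. norm y < r \<longrightarrow> norm (F y \<omega>) \<le> b"
proof -
  obtain D :: "'a set" where D: "countable D" "\<And>X. open X \<Longrightarrow> X \<noteq> {} \<Longrightarrow> \<exists>d\<in>D. d \<in> X"
    by (erule countable_dense_setE)
  have "AE \<omega> in M. \<forall>d\<in>D \<inter> ball 0 r. norm (F d \<omega>) \<le> b"
    using D(1) bd by (intro AE_ball_countable[THEN iffD2]) auto
  then show ?thesis using AE_space
  proof eventually_elim
    case (elim \<omega>)
    define X where "X = {y. norm y < r} \<inter> {y. b < norm (F y \<omega>)}"
    have "open X" unfolding X_def
      by (intro open_Int open_Collect_less continuous_intros cont elim(2))
    moreover have "d \<notin> X" if "d \<in> D" for d
      using elim(1)[rule_format, of d] that by (auto simp: X_def)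
    ultimately have "X = {}" using D(2) by blast
    then show ?case by (force simp: X_def not_less)
  qed
qed

lemma strongly_measurable_add:
  assumes "strongly_measurable M f" "strongly_measurable M g"
  shows "strongly_measurable M (\<lambda>\<omega>. f \<omega> + g \<omega>)"
proof -
  obtain s where s: "\<And>n::nat. simple_function M (s n)" "AE \<omega> in M. (\<lambda>n. s n \<omega>) \<longlonglongrightarrow> f \<omega>"
    using assms(1) unfolding strongly_measurable_def by blast
  obtain t where t: "\<And>n::nat. simple_function M (t n)" "AE \<omega> in M. (\<lambda>n. t n \<omega>) \<longlonglongrightarrow> g \<omega>"
    using assms(2) unfolding strongly_measurable_def by blast
  have "simple_function M (\<lambda>\<omega>. s n \<omega> + t n \<omega>)" for n
    by (rule simple_function_compose2[OF s(1) t(1)])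
  moreover have "AE \<omega> in M. (\<lambda>n. s n \<omega> + t n \<omega>) \<longlonglongrightarrow> f \<omega> + g \<omega>"
    using s(2) t(2) by eventually_elim (rule tendsto_add)
  ultimately show ?thesis unfolding strongly_measurable_def by (intro exI[of _ "\<lambda>n \<omega>. s n \<omega> + t n \<omega>"]) auto
qed

lemma strongly_measurable_compose:
  assumes f: "strongly_measurable M f" and h: "continuous_on UNIV h"
  shows "strongly_measurable M (\<lambda>\<omega>. h (f \<omega>))"
proof -
  obtain s where s: "\<And>n::nat. simple_function M (s n)" "AE \<omega> in M. (\<lambda>n. s n \<omega>) \<longlonglongrightarrow> f \<omega>"
    using f unfolding strongly_measurable_def by blast
  have "simple_function M (\<lambda>\<omega>. h (s n \<omega>))" for n by (rule simple_function_compose1[OF s(1)])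
  moreover have "AE \<omega> in M. (\<lambda>n. h (s n \<omega>)) \<longlonglongrightarrow> h (f \<omega>)"
    using s(2) by eventually_elim (rule continuous_on_tendsto_compose[OF h], auto)
  ultimately show ?thesis unfolding strongly_measurable_def by (intro exI[of _ "\<lambda>n \<omega>. h (s n \<omega>)"]) auto
qed

text \<open>Multipliers have this shape: their values lie in the span of finitely many fixed
  functionals, which gives strong measurability in a dual space.\<close>

lemma strongly_measurable_sum_scaleR:
  fixes a :: "nat \<Rightarrow> 'o \<Rightarrow> real"
  assumes "\<And>k. a k \<in> borel_measurable M"
  shows "strongly_measurable M (\<lambda>\<omega>. \<Sum>k<n. a k \<omega> *\<^sub>R f k)"
proof (induction n)
  case 0
  show ?case unfolding strongly_measurable_def by (intro exI[of _ "\<lambda>_ _. 0"]) auto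
next
  case (Suc n)
  have "strongly_measurable M (\<lambda>\<omega>. a n \<omega> *\<^sub>R f n)"
    by (rule strongly_measurable_compose[OF borel_measurable_imp_strongly_measurable[OF assms]])
       (intro continuous_intros)
  then show ?case using strongly_measurable_add[OF Suc.IH] by simp
qed

lemma (in prob_space) bochner_L1_sum_scaleR:
  fixes a :: "nat \<Rightarrow> 'a \<Rightarrow> real"
  assumes M: "complete_measure M"
    and a: "\<And>k. a k \<in> borel_measurable M" and B: "\<And>k. AE \<omega> in M. \<bar>a k \<omega>\<bar> \<le> B k"
  shows "(\<lambda>\<omega>. \<Sum>k<n. a k \<omega> *\<^sub>R f k) \<in> bochner_L1 M"
proof -
  interpret complete_measure M by (rule M)
  have sm: "strongly_measurable M (\<lambda>\<omega>. \<Sum>k<n. a k \<omega> *\<^sub>R f k)" by (rule strongly_measurable_sum_scaleR[OF a])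
  have "(\<lambda>\<omega>. norm (\<Sum>k<n. a k \<omega> *\<^sub>R f k)) \<in> borel_measurable M"
    by (intro strongly_measurable_imp_borel_measurable strongly_measurable_compose[OF sm] continuous_intros)
  moreover have "AE \<omega> in M. norm (norm (\<Sum>k<n. a k \<omega> *\<^sub>R f k)) \<le> (\<Sum>k<n. B k * norm (f k))"
  proof -
    have "AE \<omega> in M. \<forall>k. \<bar>a k \<omega>\<bar> \<le> B k" using B by (simp add: AE_all_countable)
    then show ?thesis
    proof eventually_elim
      case (elim \<omega>)
      have "norm (\<Sum>k<n. a k \<omega> *\<^sub>R f k) \<le> (\<Sum>k<n. norm (a k \<omega> *\<^sub>R f k))" by (rule norm_sum)
      also have "\<dots> \<le> (\<Sum>k<n. B k * norm (f k))"
        using elim by (intro sum_mono) (auto intro: mult_right_mono)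
      finally show ?case by simp
    qed
  qed
  ultimately have "integrable M (\<lambda>\<omega>. norm (\<Sum>k<n. a k \<omega> *\<^sub>R f k))" by (rule integrable_const_bound[rotated])
  then show ?thesis using sm by (simp add: bochner_L1_def)
qed

lemma zero_in_bochner_Linf: "(\<lambda>_. 0) \<in> bochner_Linf M"
  unfolding bochner_Linf_def strongly_measurable_def
  by (auto intro!: exI[of _ "\<lambda>_ _. 0"] exI[of _ "0::real"])

text \<open>The zero perturbation is admissible in the Lagrangian.\<close>

lemma weak_duality:
  fixes e :: "'x1::real_normed_vector \<Rightarrow> 'x2::real_normed_vector \<Rightarrow> 'o \<Rightarrow> 'w::real_normed_vector"
    and i :: "'x1 \<Rightarrow> 'x2 \<Rightarrow> 'o \<Rightarrow> 'r::real_normed_vector"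
  shows "dual_value M C1 C2 K J1 J2 e i \<le> primal_value M C1 C2 K J1 J2 e i"
  unfolding dual_value_def primal_value_eq_perturbed
proof (intro SUP_least INF_greatest)
  fix l :: "('o \<Rightarrow> 'w \<Rightarrow>\<^sub>L real) \<times> ('o \<Rightarrow> 'r \<Rightarrow>\<^sub>L real)" and x :: "'x1 \<times> ('o \<Rightarrow> 'x2)"
  assume "l \<in> multiplier_space M" and x: "x \<in> primal_space M"
  have 0: "(\<lambda>_. 0, \<lambda>_. 0) \<in> perturbation_space M"
    unfolding perturbation_space_def by (intro SigmaI zero_in_bochner_Linf)
  have "dual_objective M C1 C2 K J1 J2 e i l \<le> lagrangian M C1 C2 K J1 J2 e i x l"
    unfolding dual_objective_def by (rule INF_lower[OF x])
  also have "\<dots> \<le> ereal (pairing M (\<lambda>_. 0, \<lambda>_. 0) l) + perturbed_objective M C1 C2 K J1 J2 e i x (\<lambda>_. 0, \<lambda>_. 0)"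
    unfolding lagrangian_def by (rule INF_lower[OF 0])
  also have "\<dots> = perturbed_objective M C1 C2 K J1 J2 e i x (\<lambda>_. 0, \<lambda>_. 0)"
    by (simp add: pairing_def zero_ereal_def[symmetric])
  finally show "dual_objective M C1 C2 K J1 J2 e i l \<le> perturbed_objective M C1 C2 K J1 J2 e i x (\<lambda>_. 0, \<lambda>_. 0)" .
qed

theorem theorem3p4:
  fixes M :: "'o measure"
    and C1 :: "'x1::{banach, second_countable_topology} set"
    and C2 :: "'x2::{banach, second_countable_topology} set"
    and K :: "'r::{banach, second_countable_topology} set"
    and J1 :: "'x1 \<Rightarrow> real"
    and J2 :: "'x1 \<Rightarrow> 'x2 \<Rightarrow> real"
    and e :: "'x1 \<Rightarrow> 'x2 \<Rightarrow> 'o \<Rightarrow> 'w::{banach, second_countable_topology}"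
    and i :: "'x1 \<Rightarrow> 'x2 \<Rightarrow> 'o \<Rightarrow> 'r"
  assumes "prob_space M" and "complete_measure M"
    and "reflexive_space TYPE('x1)" and "reflexive_space TYPE('x2)"
    and "reflexive_space TYPE('w)" and "reflexive_space TYPE('r)"
    and "basic_assumption M C1 C2 K J1 J2 e i"
    and J_cont: "continuous_on UNIV (\<lambda>(x1, x2). J1 x1 + J2 x1 x2)"
    and "bounded C1" and "bounded C2"
  shows "-\<infinity> < primal_value M C1 C2 K J1 J2 e i \<and>
         (\<exists>x\<in>primal_space M.
            perturbed_objective M C1 C2 K J1 J2 e i x (\<lambda>_. 0, \<lambda>_. 0) =
              primal_value M C1 C2 K J1 J2 e i) \<and>
         primal_value M C1 C2 K J1 J2 e i = dual_value M C1 C2 K J1 J2 e i"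
proof -
  note basic = assms(7)[unfolded basic_assumption_def]
  have K: "K \<noteq> {}" "closed K" "convex K" "cone K"
    and J_convex: "convex_on UNIV (\<lambda>(x1, x2). J1 x1 + J2 x1 x2)"
    and J2_bounded: "\<forall>r>0. \<exists>a>0. \<forall>x1 x2. norm x1 + norm x2 \<le> r \<longrightarrow> \<bar>J2 x1 x2\<bar> \<le> a"
    and e_linear: "\<forall>\<omega>\<in>space M. bounded_linear (\<lambda>(x1, x2). e x1 x2 \<omega>)"
    and i_cont: "\<forall>\<omega>\<in>space M. continuous_on UNIV (\<lambda>(x1, x2). i x1 x2 \<omega>)"
    and i_convex: "\<forall>\<omega>\<in>space M. cone_convex K (\<lambda>(x1, x2). i x1 x2 \<omega>)"
    and e_meas: "\<forall>x1 x2. e x1 x2 \<in> borel_measurable M"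
    and i_meas: "\<forall>x1 x2. i x1 x2 \<in> borel_measurable M"
    and e_bounded: "\<forall>r>0. \<exists>b>0. \<forall>x1 x2. norm x1 + norm x2 \<le> r \<longrightarrow> (AE \<omega> in M. norm (e x1 x2 \<omega>) \<le> b)"
    and i_bounded: "\<forall>r>0. \<exists>b>0. \<forall>x1 x2. norm x1 + norm x2 \<le> r \<longrightarrow> (AE \<omega> in M. norm (i x1 x2 \<omega>) \<le> b)"
    using basic by - (elim conjE, assumption)+
  interpret prob_space M by (rule assms(1))
  interpret complete_measure M by (rule assms(2))
  interpret two_stage M C1 C2
    by unfold_locales (use assms(2-4,9,10) basic in \<open>auto intro: reflexive_space_prod\<close>)

  have pair_bound: "norm x1 + norm x2 \<le> 2 * norm (x1, x2)" for x1 :: 'x1 and x2 :: 'x2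
    using norm_fst_le[of x1 x2] norm_snd_le[of x2 x1] by linarith
  obtain R where R: "\<And>y. y \<in> decisions \<Longrightarrow> AE \<omega> in M. norm (y \<omega>) \<le> R" and R0: "0 \<le> R"
  proof -
    obtain R where "\<And>y. y \<in> decisions \<Longrightarrow> AE \<omega> in M. norm (y \<omega>) \<le> R" using decisions_bounded by blast
    then have "AE \<omega> in M. norm (y \<omega>) \<le> max R 0" if "y \<in> decisions" for y
      using that by (metis (mono_tags, lifting) eventually_mono max.coboundedI1)
    then show ?thesis by (intro that[of "max R 0"]) auto
  qed

  \<comment> \<open>The objective as a convex integrand\<close>
  define J :: "'x1 \<times> 'x2 \<Rightarrow> 'o \<Rightarrow> real" where "J y \<omega> = J1 (fst y) + J2 (fst y) (snd y)" for y \<omega>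
  have Jeq: "(\<lambda>y. J y \<omega>) = (\<lambda>(x1, x2). J1 x1 + J2 x1 x2)" for \<omega> by (auto simp: J_def)
  have Jconv: "convex_on UNIV (\<lambda>y. J y \<omega>)" and Jcont: "continuous_on UNIV (\<lambda>y. J y \<omega>)" for \<omega>
    using J_convex J_cont by (simp_all only: Jeq)
  have J: "convex_integrand J" unfolding convex_integrand_def
  proof (intro conjI ballI)
    \<comment> \<open>\<open>J\<close> is constant in \<omega>, so any argument serves. Its affine
      minorant at 0 is bounded below on the bounded set \<open>C1 \<times> C2\<close>.\<close>
    have "isCont (\<lambda>y. J y undefined) 0" using Jcont by (rule continuous_on_interior) simp
    from exists_subgradient[OF Jconv this]
    obtain f :: "('x1 \<times> 'x2) \<Rightarrow>\<^sub>L real" where "\<And>y. J 0 undefined + f (y - 0) \<le> J y undefined"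
      by blast
    then have f: "J 0 undefined + f y \<le> J y undefined" for y by (metis diff_zero)
    obtain S where S: "\<And>y. y \<in> C1 \<times> C2 \<Longrightarrow> norm y \<le> S"
      using bounded_Times[OF C1(4) C2(4)] by (auto simp: bounded_iff)
    have "- (norm f * S - J 0 undefined) \<le> J y \<omega>" if "y \<in> C1 \<times> C2" for y \<omega>
    proof -
      have "\<bar>f y\<bar> \<le> norm f * S"
        using norm_blinfun[of f y] mult_left_mono[OF S[OF that], of "norm f"] by simp
      then show ?thesis using f[of y] by (simp add: J_def)
    qed
    then show "\<exists>b. \<forall>\<omega>\<in>space M. \<forall>y\<in>C1 \<times> C2. - b \<le> J y \<omega>" by blast
  next
    fix y assume y: "y \<in> decisions"
    obtain a where a: "\<And>\<omega>. fst (y \<omega>) = a" using y unfolding decisions_def by blast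
    have "2 * R + 1 > 0" using R0 by simp
    then obtain b where b: "\<And>x1 x2. norm x1 + norm x2 \<le> 2 * R + 1 \<Longrightarrow> \<bar>J2 x1 x2\<bar> \<le> b"
      using J2_bounded[rule_format, of "2 * R + 1"] by auto
    show "integrable M (\<lambda>\<omega>. J (y \<omega>) \<omega>)"
    proof (rule integrable_const_bound)
      show "AE \<omega> in M. norm (J (y \<omega>) \<omega>) \<le> \<bar>J1 a\<bar> + b"
        using R[OF y]
      proof eventually_elim
        case (elim \<omega>)
        then have "\<bar>J2 (fst (y \<omega>)) (snd (y \<omega>))\<bar> \<le> b" using pair_bound[of "fst (y \<omega>)" "snd (y \<omega>)"] by (intro b) simp
        then show ?case by (simp add: J_def a)
      qed
      show "(\<lambda>\<omega>. J (y \<omega>) \<omega>) \<in> borel_measurable M"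
        by (rule caratheodory_measurable[OF Jcont _ decisions_measurable[OF y]]) (simp add: J_def)
    qed
  qed (simp_all add: Jconv Jcont)
  have expected_J: "expected J z = objective M J1 J2 (a, \<lambda>\<omega>. snd (z \<omega>))"
    if z: "z \<in> decisions" and a: "\<And>\<omega>. fst (z \<omega>) = a" for z a
  proof -
    have "integrable M (\<lambda>\<omega>. J (z \<omega>) \<omega>)" using J z by (auto simp: convex_integrand_def)
    then have "integrable M (\<lambda>\<omega>. J (z \<omega>) \<omega> - J1 a)" by simp
    \<comment> \<open>The first component is constant, so the \<open>J1\<close> term is a constant
      and can be split off the integral as in \<open>objective\<close>.\<close>
    then have "integrable M (\<lambda>\<omega>. J2 a (snd (z \<omega>)))" by (simp add: J_def a)
    then show ?thesis by (simp add: expected_def objective_def J_def a prob_space)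
  qed

  \<comment> \<open>The constraint map and its uniform bound\<close>
  define G :: "'x1 \<times> 'x2 \<Rightarrow> 'o \<Rightarrow> 'w \<times> 'r" where "G y \<omega> = (e (fst y) (snd y) \<omega>, i (fst y) (snd y) \<omega>)" for y \<omega>
  have elin: "bounded_linear (\<lambda>y. e (fst y) (snd y) \<omega>)" if "\<omega> \<in> space M" for \<omega>
    using e_linear that by (simp add: case_prod_beta')
  have Gcont: "continuous_on UNIV (\<lambda>y. G y \<omega>)" if "\<omega> \<in> space M" for \<omega>
    using i_cont that unfolding G_def
    by (intro continuous_on_Pair linear_continuous_on[OF elin]) (simp_all add: case_prod_beta')
  have Gmeas: "G y \<in> borel_measurable M" for y
    using e_meas i_meas unfolding G_def[abs_def] by (intro borel_measurable_Pair) simp_all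
  \<comment> \<open>The open ball of radius R + 1 contains the values of all decisions, which have
    norm at most R almost surely.\<close>
  have "\<exists>b. AE \<omega> in M. \<forall>y. norm y < R + 1 \<longrightarrow> norm (G y \<omega>) \<le> b"
  proof -
    have pos: "2 * (R + 1) > 0" using R0 by simp
    obtain be where be: "\<And>x1 x2. norm x1 + norm x2 \<le> 2 * (R + 1) \<Longrightarrow> AE \<omega> in M. norm (e x1 x2 \<omega>) \<le> be"
      using e_bounded[rule_format, OF pos] by auto
    obtain bi where bi: "\<And>x1 x2. norm x1 + norm x2 \<le> 2 * (R + 1) \<Longrightarrow> AE \<omega> in M. norm (i x1 x2 \<omega>) \<le> bi"
      using i_bounded[rule_format, OF pos] by auto
    have "AE \<omega> in M. norm (G y \<omega>) \<le> be + bi" if "norm y < R + 1" for y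
    proof -
      have le: "norm (fst y) + norm (snd y) \<le> 2 * (R + 1)"
        using that pair_bound[of "fst y" "snd y"] by simp
      show ?thesis using be[OF le] bi[OF le]
      proof eventually_elim
        case (elim \<omega>)
        then show ?case using norm_Pair_le[of "e (fst y) (snd y) \<omega>" "i (fst y) (snd y) \<omega>"] by (simp add: G_def)
      qed
    qed
    with Gcont have "AE \<omega> in M. \<forall>y. norm y < R + 1 \<longrightarrow> norm (G y \<omega>) \<le> be + bi"
      by (rule AE_ball_bounded)
    then show ?thesis by (rule exI)
  qed
  then obtain b where b: "AE \<omega> in M. \<forall>y. norm y < R + 1 \<longrightarrow> norm (G y \<omega>) \<le> b" by blast
  have Gb: "AE \<omega> in M. norm (G (y \<omega>) \<omega>) \<le> b" if "y \<in> decisions" for y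
    using b R[OF that]
  proof eventually_elim
    case (elim \<omega>)
    from elim(2) show ?case by (intro elim(1)[rule_format]) simp
  qed

  \<comment> \<open>Scalar constraints from the cone\<close>
  have "\<exists>f :: nat \<Rightarrow> ('w \<times> 'r) \<Rightarrow>\<^sub>L real. \<forall>z. z \<in> {0} \<times> K \<longleftrightarrow> (\<forall>k. 0 \<le> f k z)"
    by (rule closed_convex_cone_countable_halfspaces)
       (use K in \<open>auto intro!: convex_Times closed_Times simp: cone_def\<close>)
  then obtain \<kappa> :: "nat \<Rightarrow> ('w \<times> 'r) \<Rightarrow>\<^sub>L real" where \<kappa>: "\<And>z. z \<in> {0} \<times> K \<longleftrightarrow> (\<forall>k. 0 \<le> \<kappa> k z)" by blast
  define c where "c k y \<omega> = \<kappa> k (G y \<omega>)" for k y \<omega>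
  have \<kappa>_bound: "AE \<omega> in M. \<bar>\<kappa> k (u \<omega>)\<bar> \<le> norm (\<kappa> k) * B" if "AE \<omega> in M. norm (u \<omega>) \<le> B" for k u B
    using that
  proof eventually_elim
    case (elim \<omega>)
    then show ?case using norm_blinfun[of "\<kappa> k" "u \<omega>"] mult_left_mono[OF elim, of "norm (\<kappa> k)"] by simp
  qed
  have \<kappa>_meas: "(\<lambda>\<omega>. \<kappa> k (u \<omega>)) \<in> borel_measurable M" if "u \<in> borel_measurable M" for k u
    by (intro borel_measurable_continuous_on[OF _ that] continuous_intros)
  have Gy_meas: "(\<lambda>\<omega>. G (y \<omega>) \<omega>) \<in> borel_measurable M" if "y \<in> decisions" for y
    by (rule caratheodory_measurable[OF Gcont Gmeas decisions_measurable[OF that]])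
  have c: "convex_constraints c" unfolding convex_constraints_def
  proof (intro conjI allI ballI)
    fix k \<omega> assume \<omega>: "\<omega> \<in> space M"
    show "continuous_on UNIV (\<lambda>y. c k y \<omega>)"
      unfolding c_def by (intro continuous_intros Gcont \<omega>)
    show "convex_on UNIV (\<lambda>y. c k y \<omega>)"
    proof (rule convex_onI)
      fix t :: real and x y :: "'x1 \<times> 'x2" assume t: "0 < t" "t < 1"
      let ?z = "(1 - t) *\<^sub>R x + t *\<^sub>R y"
      have "cone_convex K (\<lambda>y. i (fst y) (snd y) \<omega>)"
        using i_convex \<omega> by (simp add: case_prod_beta')
      from this[unfolded cone_convex_def, THEN spec, THEN spec, THEN bspec, of "1 - t" x y] t
      have ci: "(1 - t) *\<^sub>R i (fst x) (snd x) \<omega> + t *\<^sub>R i (fst y) (snd y) \<omega> - i (fst ?z) (snd ?z) \<omega> \<in> K"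
        by (simp add: cone_le_def)
      interpret E: bounded_linear "\<lambda>y. e (fst y) (snd y) \<omega>" by (rule elin[OF \<omega>])
      have ce: "e (fst ?z) (snd ?z) \<omega> = (1 - t) *\<^sub>R e (fst x) (snd x) \<omega> + t *\<^sub>R e (fst y) (snd y) \<omega>"
        using E.add[of "(1 - t) *\<^sub>R x" "t *\<^sub>R y"] E.scaleR[of "1 - t" x] E.scaleR[of t y] by simp
      \<comment> \<open>Linearity of \<open>e\<close> gives the component 0 and cone-convexity of
        \<open>i\<close> the one in \<open>K\<close>, so \<open>G\<close> is convex for the order of
        \<open>{0} \<times> K\<close>, which every \<open>\<kappa> k\<close> respects.\<close>
      have "(1 - t) *\<^sub>R G x \<omega> + t *\<^sub>R G y \<omega> - G ?z \<omega> \<in> {0} \<times> K"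
        unfolding G_def ce using ci by simp
      then have "0 \<le> \<kappa> k ((1 - t) *\<^sub>R G x \<omega> + t *\<^sub>R G y \<omega> - G ?z \<omega>)"
        by (rule \<kappa>[THEN iffD1, rule_format])
      then show "c k ?z \<omega> \<le> (1 - t) * c k x \<omega> + t * c k y \<omega>"
        by (simp add: c_def blinfun.add_right blinfun.diff_right blinfun.scaleR_right)
    qed simp
  next
    fix k y assume y: "y \<in> decisions"
    show "(\<lambda>\<omega>. c k (y \<omega>) \<omega>) \<in> borel_measurable M"
      unfolding c_def by (rule \<kappa>_meas[OF Gy_meas[OF y]])
    show "\<exists>B. AE \<omega> in M. \<bar>c k (y \<omega>) \<omega>\<bar> \<le> B"
      unfolding c_def using \<kappa>_bound[OF Gb[OF y]] by blast
  qed

  \<comment> \<open>Penalized minimizers and their dual points\<close>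
  have "\<exists>y\<in>decisions. \<forall>z\<in>decisions. expected (penalized J c n) y \<le> expected (penalized J c n) z" for n
    by (rule expected_attains_min[OF convex_integrand_penalized[OF J c]])
  then obtain ym where ym: "\<And>n. ym n \<in> decisions"
    and ymin: "\<And>n z. z \<in> decisions \<Longrightarrow> expected (penalized J c n) (ym n) \<le> expected (penalized J c n) z"
    by metis
  define p where "p n = expected (penalized J c n) (ym n)" for n

  have dual_ge: "ereal (p n) \<le> dual_value M C1 C2 K J1 J2 e i" for n
  proof -
    \<comment> \<open>The derivative of the penalty n (max 0 s)^2 at the minimizer.\<close>
    define a where "a k \<omega> = 2 * real n * max 0 (c k (ym n \<omega>) \<omega>)" for k \<omega>
    have am: "a k \<in> borel_measurable M" for k
      using constraint_measurable[OF c ym, of k n] unfolding a_def[abs_def] by measurable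
    have a0: "0 \<le> a k \<omega>" for k \<omega> by (simp add: a_def)
    have "\<exists>B. AE \<omega> in M. \<bar>a k \<omega>\<bar> \<le> B" for k
    proof -
      obtain B where "AE \<omega> in M. \<bar>max 0 (c k (ym n \<omega>) \<omega>)\<bar> \<le> B" using constraint_pos_bounded[OF c ym] by blast
      then have "AE \<omega> in M. \<bar>a k \<omega>\<bar> \<le> 2 * real n * B"
        by eventually_elim (auto simp: a_def abs_mult intro!: mult_left_mono)
      then show ?thesis by blast
    qed
    then obtain B where aB: "\<And>k. AE \<omega> in M. \<bar>a k \<omega>\<bar> \<le> B k" by metis
    have "\<exists>f1 f2. \<forall>w r. \<kappa> k (w, r) = blinfun_apply f1 w + blinfun_apply f2 r" for k
      by (rule blinfun_Pair_split[of "\<kappa> k"]) blast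
    then obtain \<kappa>e \<kappa>i where \<kappa>ei: "\<And>k w r. \<kappa> k (w, r) = blinfun_apply (\<kappa>e k) w + blinfun_apply (\<kappa>i k) r" by metis
    define l where "l = ((\<lambda>\<omega>. \<Sum>k<n. a k \<omega> *\<^sub>R \<kappa>e k), (\<lambda>\<omega>. \<Sum>k<n. a k \<omega> *\<^sub>R \<kappa>i k))"
    have lM: "l \<in> multiplier_space M"
      unfolding l_def multiplier_space_def
      by (intro SigmaI bochner_L1_sum_scaleR[OF assms(2) am aB])
    have "ereal (p n) \<le> dual_objective M C1 C2 K J1 J2 e i l"
      unfolding dual_objective_def lagrangian_def
    proof (intro INF_greatest)
      fix x :: "'x1 \<times> ('o \<Rightarrow> 'x2)" and u :: "('o \<Rightarrow> 'w) \<times> ('o \<Rightarrow> 'r)"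
      assume x: "x \<in> primal_space M" and u: "u \<in> perturbation_space M"
      show "ereal (p n) \<le> ereal (pairing M u l) + perturbed_objective M C1 C2 K J1 J2 e i x u"
      proof (cases "perturbed_objective M C1 C2 K J1 J2 e i x u = \<infinity>")
        case False
        then have feas: "fst x \<in> C1" "AE \<omega> in M. snd x \<omega> \<in> C2 \<and> e (fst x) (snd x \<omega>) \<omega> = fst u \<omega> \<and>
            cone_le K (i (fst x) (snd x \<omega>) \<omega>) (snd u \<omega>)"
          and po: "perturbed_objective M C1 C2 K J1 J2 e i x u = ereal (objective M J1 J2 x)"
          by (auto simp: perturbed_objective_def split: if_splits)
        define z where "z \<omega> = (fst x, snd x \<omega>)" for \<omega>
        have "snd x \<in> borel_measurable M"
          using x by (auto simp: primal_space_def bochner_Linf_def intro: strongly_measurable_imp_borel_measurable)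
        then have "z \<in> borel_measurable M" unfolding z_def[abs_def] by (intro borel_measurable_Pair) auto
        moreover have "AE \<omega> in M. z \<omega> \<in> C1 \<times> C2"
          using feas(2) by eventually_elim (simp add: z_def feas(1))
        ultimately have z: "z \<in> decisions" by (auto simp: decisions_def z_def)
        have Jz: "expected J z = objective M J1 J2 x"
          using expected_J[OF z, of "fst x"] by (simp add: z_def)
        define v where "v \<omega> = (fst u \<omega>, snd u \<omega>)" for \<omega>
        have "fst u \<in> bochner_Linf M" "snd u \<in> bochner_Linf M" using u by (auto simp: perturbation_space_def)
        then obtain B1 B2 where uB: "AE \<omega> in M. norm (fst u \<omega>) \<le> B1" "AE \<omega> in M. norm (snd u \<omega>) \<le> B2"
          and um: "fst u \<in> borel_measurable M" "snd u \<in> borel_measurable M"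
          by (auto simp: bochner_Linf_def intro: strongly_measurable_imp_borel_measurable)
        have vm: "v \<in> borel_measurable M" unfolding v_def[abs_def] using um by (intro borel_measurable_Pair) auto
        have vB: "AE \<omega> in M. norm (v \<omega>) \<le> B1 + B2"
          using uB
        proof eventually_elim
          case (elim \<omega>)
          then show ?case using norm_Pair_le[of "fst u \<omega>" "snd u \<omega>"] by (simp add: v_def)
        qed
        have int_v: "integrable M (\<lambda>\<omega>. a k \<omega> * \<kappa> k (v \<omega>))" for k
          by (rule integrable_mult_AE_bounded[OF am aB \<kappa>_meas[OF vm] \<kappa>_bound[OF vB]])
        have int_z: "integrable M (\<lambda>\<omega>. a k \<omega> * c k (z \<omega>) \<omega>)" for k
          unfolding c_def by (rule integrable_mult_AE_bounded[OF am aB \<kappa>_meas[OF Gy_meas[OF z]] \<kappa>_bound[OF Gb[OF z]]])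
        \<comment> \<open>The perturbation dominates the constraint values in the cone order, and
          the weights \<open>a k\<close> are nonnegative. Replacing it by
          \<open>G (z \<omega>) \<omega>\<close> therefore can only lower the pairing.\<close>
        have "AE \<omega> in M. v \<omega> - G (z \<omega>) \<omega> \<in> {0} \<times> K"
          using feas(2) by eventually_elim (auto simp: v_def G_def z_def cone_le_def)
        then have le: "AE \<omega> in M. a k \<omega> * c k (z \<omega>) \<omega> \<le> a k \<omega> * \<kappa> k (v \<omega>)" for k
        proof eventually_elim
          case (elim \<omega>)
          then have "0 \<le> \<kappa> k (v \<omega> - G (z \<omega>) \<omega>)" by (rule \<kappa>[THEN iffD1, rule_format])
          then show ?case using a0 by (intro mult_left_mono) (auto simp: c_def blinfun.diff_right)
        qed
        have pw: "blinfun_apply (fst l \<omega>) (fst u \<omega>) + blinfun_apply (snd l \<omega>) (snd u \<omega>)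
            = (\<Sum>k<n. a k \<omega> * \<kappa> k (v \<omega>))" for \<omega>
          by (simp add: l_def v_def \<kappa>ei blinfun.sum_left blinfun.scaleR_left sum.distrib distrib_left)
        have "pairing M u l = (\<integral>\<omega>. (\<Sum>k<n. a k \<omega> * \<kappa> k (v \<omega>)) \<partial>M)"
          unfolding pairing_def by (simp only: pw)
        also have "\<dots> = (\<Sum>k<n. \<integral>\<omega>. a k \<omega> * \<kappa> k (v \<omega>) \<partial>M)"
          using int_v by (intro Bochner_Integration.integral_sum) auto
        finally have "(\<Sum>k<n. \<integral>\<omega>. a k \<omega> * c k (z \<omega>) \<omega> \<partial>M) \<le> pairing M u l"
          using int_v int_z le by (auto intro!: sum_mono integral_mono_AE)
        moreover have "p n \<le> expected J z + (\<Sum>k<n. \<integral>\<omega>. a k \<omega> * c k (z \<omega>) \<omega> \<partial>M)"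
          unfolding p_def a_def by (rule penalized_multipliers[OF J c ym ymin z])
        ultimately show ?thesis by (simp add: po Jz)
      qed simp
    qed
    also have "\<dots> \<le> dual_value M C1 C2 K J1 J2 e i"
      unfolding dual_value_def by (rule SUP_upper[OF lM])
    finally show ?thesis .
  qed

  \<comment> \<open>Closing the duality gap\<close>
  have weak: "dual_value M C1 C2 K J1 J2 e i \<le> primal_value M C1 C2 K J1 J2 e i"
    by (rule weak_duality)
  show ?thesis
  proof (cases "bdd_above (range p)")
    case True
    define \<alpha> where "\<alpha> = (SUP n. p n)"
    have "\<exists>y\<in>decisions. expected (penalized J c n) y \<le> \<alpha>" for n
      using ym[of n] cSUP_upper[OF UNIV_I True, of n] unfolding \<alpha>_def p_def by blast
    then obtain y where y: "y \<in> decisions" "expected J y \<le> \<alpha>" "AE \<omega> in M. \<forall>k. c k (y \<omega>) \<omega> \<le> 0"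
      using penalized_limit[OF J c] by blast
    obtain a where a: "\<And>\<omega>. fst (y \<omega>) = a" using y unfolding decisions_def by blast
    define x where "x = (a, \<lambda>\<omega>. snd (y \<omega>))"
    have "(\<lambda>\<omega>. snd (y \<omega>)) \<in> borel_measurable M"
      by (intro borel_measurable_continuous_on[OF _ decisions_measurable[OF y(1)]] continuous_intros)
    moreover have "AE \<omega> in M. norm (snd (y \<omega>)) \<le> R"
      using R[OF y(1)]
      by eventually_elim (use norm_snd_le in \<open>metis order_trans prod.collapse\<close>)
    ultimately have xp: "x \<in> primal_space M"
      by (auto simp: x_def primal_space_def bochner_Linf_def intro: borel_measurable_imp_strongly_measurable)
    have feas: "AE \<omega> in M. a \<in> C1 \<and> snd x \<omega> \<in> C2 \<and> e (fst x) (snd x \<omega>) \<omega> = 0 \<and> cone_le K (i (fst x) (snd x \<omega>) \<omega>) 0"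
      using decisions_AE[OF y(1)] y(3)
    proof eventually_elim
      case (elim \<omega>)
      have "0 \<le> \<kappa> k (- G (y \<omega>) \<omega>)" for k using elim(2) by (simp add: c_def blinfun.minus_right)
      then have "- G (y \<omega>) \<omega> \<in> {0} \<times> K" by (intro \<kappa>[THEN iffD2] allI)
      then show ?case using elim(1) a[of \<omega>] by (auto simp: x_def G_def cone_le_def mem_Times_iff)
    qed
    then have "AE \<omega> in M. a \<in> C1" by eventually_elim simp
    then have "a \<in> C1" by simp
    then have xf: "x \<in> primal_feasible M C1 C2 K e i"
      using xp feas by (auto simp: primal_feasible_def x_def)
    have obj: "objective M J1 J2 x \<le> \<alpha>" using expected_J[OF y(1) a] y(2) by (simp add: x_def)
    have px: "perturbed_objective M C1 C2 K J1 J2 e i x (\<lambda>_. 0, \<lambda>_. 0) = ereal (objective M J1 J2 x)"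
      using xf by (simp add: primal_feasible_def perturbed_objective_def)
    have "primal_value M C1 C2 K J1 J2 e i \<le> ereal (objective M J1 J2 x)"
      unfolding primal_value_def by (rule INF_lower[OF xf])
    moreover have "ereal (objective M J1 J2 x) \<le> ereal \<alpha>" using obj by simp
    moreover have "ereal \<alpha> \<le> dual_value M C1 C2 K J1 J2 e i"
    \<comment> \<open>The dual value is still extended real here, so it is compared through its real
      upper bounds.\<close>
    proof (rule ereal_le_real)
      fix z assume z: "dual_value M C1 C2 K J1 J2 e i \<le> ereal z"
      then have "p n \<le> z" for n using dual_ge[of n] by (metis ereal_less_eq(3) order_trans)
      then have "\<alpha> \<le> z" unfolding \<alpha>_def by (intro cSUP_least) auto
      then show "ereal \<alpha> \<le> ereal z" by simp
    qed
    ultimately have up: "primal_value M C1 C2 K J1 J2 e i \<le> ereal (objective M J1 J2 x)"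
      and down: "ereal (objective M J1 J2 x) \<le> dual_value M C1 C2 K J1 J2 e i"
      by (blast, blast intro: order_trans)
    have "primal_value M C1 C2 K J1 J2 e i = ereal (objective M J1 J2 x)"
      by (rule antisym[OF up order_trans[OF down weak]])
    moreover have "primal_value M C1 C2 K J1 J2 e i = dual_value M C1 C2 K J1 J2 e i"
      by (rule antisym[OF order_trans[OF up down] weak])
    ultimately show ?thesis using px xp by auto
  next
    case False
    have "dual_value M C1 C2 K J1 J2 e i = \<infinity>"
    proof (rule ereal_top)
      fix B
      obtain n where "B < p n" using False by (auto simp: bdd_above_def not_le)
      then show "ereal B \<le> dual_value M C1 C2 K J1 J2 e i" using dual_ge[of n] by (intro order_trans[OF _ dual_ge[of n]]) simp
    qed
    then have D: "dual_value M C1 C2 K J1 J2 e i = \<infinity>" and P: "primal_value M C1 C2 K J1 J2 e i = \<infinity>"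
      using weak by auto
    \<comment> \<open>In the infeasible case any point attains the value \<infinity>; the origin is
      a convenient one.\<close>
    have x: "(0, \<lambda>_. 0) \<in> primal_space M"
      unfolding primal_space_def by (intro SigmaI UNIV_I zero_in_bochner_Linf)
    then have "primal_value M C1 C2 K J1 J2 e i
        \<le> perturbed_objective M C1 C2 K J1 J2 e i (0, \<lambda>_. 0) (\<lambda>_. 0, \<lambda>_. 0)"
      unfolding primal_value_eq_perturbed by (rule INF_lower)
    then show ?thesis using D P x by auto
  qed
qed

end
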